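(* There is an algebra inclusion \[ \eta:\mathbb{C}_F[S^4]\hookrightarrow\mathbb{C}_F^-[\mathbb{CP}^3] \] given by \[ \eta(a)=a+b,\quad \eta(z)=e^{\imath\theta}y+v^*,\quad \eta(w)=w-z^* \] (and on adjoint generators by $\eta(z^* )=\eta(z)^*$, $\eta(w^* )=\eta(w)^*$).
   Context: Let $\theta$ be a real parameter. $\mathbb{C}_F[S^4]$ is the unital $*$-algebra with generators $a=a^*$, $z,w,z^*,w^*$, with $a$ central, $z$ and $w$ normal (commuting with their adjoints), and relations \[ zw=e^{-\imath\theta}wz,\quad zw^*=e^{\imath\theta}w^*z,\quad z^*z+w^*w=a(1-a). \] $\mathbb{C}^-_F[\mathbb{CP}^3]$ is the unital $*$-algebra generated by the entries of \[ \hat Q=\begin{pmatrix} a & x & y & z \\ x^* & b & w & v \\ y^* & w^* & c & u \\ z^* & v^* & u^* & d \end{pmatrix},\qquad a,b,c,d\ \text{self-adjoint and central},\quad a+b+c+d=1, \] with $x,y,z,u,v,w$ normal (the symbols $a,z,w$ on the right-hand sides of the formulae for $\eta$ are the generators of this algebra). With $X=x^*x$, $Y=y^*y$, $Z=z^*z$, $U=u^*u$, $V=v^*v$, $W=w^*w$, the relations are \[ X=ab,\quad Y=ac,\quad Z=ad,\quad U=cd,\quad V=bd,\quad W=bc, \] \[ au=y^*z,\quad av=x^*z,\quad aw=x^*y,\quad bu=w^*v,\quad cv=wu,\quad dw=vu^*, \] \[ cx=yw^*,\quad by=xw,\quad bz=xv,\quad dx=zv^*,\quad dy=zu^*,\quad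 cz=yu, \] and commutation relations \[ xz=e^{\imath\theta}zx,\quad yx=e^{\imath\theta}xy,\quad yz=e^{\imath\theta}zy,\quad uv=e^{\imath\theta}vu,\quad uw=e^{\imath\theta}wu,\quad vw=e^{\imath\theta}wv, \] \[ xu=e^{2\imath\theta}ux,\quad xv=e^{\imath\theta}vx,\quad xw=e^{-\imath\theta}wx,\quad yu=e^{\imath\theta}uy,\quad yv=vy,\quad yw=e^{-\imath\theta}wy, \] \[ zu=e^{\imath\theta}uz,\quad zv=e^{\imath\theta}vz,\quad zw=wz, \] together with the relations with inverse factor obtained when one generator is replaced by its adjoint (if $pq=\lambda qp$ then $pq^*=\lambda^{-1}q^*p$). *)

theory Defs
  imports Complex_Main "HOL-Library.Poly_Mapping" "HOL-Algebra.QuotRing" "HOL-Algebra.Module"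
begin

section \<open>Complex unital *-algebras\<close>

record 'a star_alg = "(complex, 'a) module" +
  star :: "'a \<Rightarrow> 'a"

locale star_algebra = ring A for A (structure) +
  assumes smult_closed: "x \<in> carrier A \<Longrightarrow> c \<odot> x \<in> carrier A"
    and smult_add_left: "x \<in> carrier A \<Longrightarrow> (c + d) \<odot> x = c \<odot> x \<oplus> d \<odot> x"
    and smult_add_right: "\<lbrakk>x \<in> carrier A; y \<in> carrier A\<rbrakk> \<Longrightarrow> c \<odot> (x \<oplus> y) = c \<odot> x \<oplus> c \<odot> y"
    and smult_smult: "x \<in> carrier A \<Longrightarrow> (c * d) \<odot> x = c \<odot> (d \<odot> x)"
    and smult_one: "x \<in> carrier A \<Longrightarrow> 1 \<odot> x = x"
    and smult_mult_left: "\<lbrakk>x \<in> carrier A; y \<in> carrier A\<rbrakk> \<Longrightarrow> (c \<odot> x) \<otimes> y = c \<odot> (x \<otimes> y)"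
    and smult_mult_right: "\<lbrakk>x \<in> carrier A; y \<in> carrier A\<rbrakk> \<Longrightarrow> x \<otimes> (c \<odot> y) = c \<odot> (x \<otimes> y)"
    and star_closed: "x \<in> carrier A \<Longrightarrow> star A x \<in> carrier A"
    and star_star: "x \<in> carrier A \<Longrightarrow> star A (star A x) = x"
    and star_add: "\<lbrakk>x \<in> carrier A; y \<in> carrier A\<rbrakk> \<Longrightarrow> star A (x \<oplus> y) = star A x \<oplus> star A y"
    and star_mult: "\<lbrakk>x \<in> carrier A; y \<in> carrier A\<rbrakk> \<Longrightarrow> star A (x \<otimes> y) = star A y \<otimes> star A x"
    and star_smult: "x \<in> carrier A \<Longrightarrow> star A (c \<odot> x) = cnj c \<odot> star A x"

text \<open>Homomorphisms are unital: \<^const>\<open>ring_hom\<close> preserves the unit.\<close>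

definition star_alg_hom :: "('a, 'm) star_alg_scheme \<Rightarrow> ('b, 'n) star_alg_scheme \<Rightarrow> ('a \<Rightarrow> 'b) set"
  where "star_alg_hom A B =
    {h \<in> ring_hom A B.
      (\<forall>c. \<forall>x\<in>carrier A. h (c \<odot>\<^bsub>A\<^esub> x) = c \<odot>\<^bsub>B\<^esub> h x) \<and>
      (\<forall>x\<in>carrier A. h (star A x) = star B (h x))}"

section \<open>The free unital *-algebra\<close>

datatype 'g letter = Gen 'g | Adj 'g

fun flip :: "'g letter \<Rightarrow> 'g letter" where
  "flip (Gen g) = Adj g"
| "flip (Adj g) = Gen g"

text \<open>Words form a free monoid, written additively because that is how
  the convolution product of \<^type>\<open>poly_mapping\<close> expects its exponents.
  Concatenation is not commutative.\<close>

datatype 'g word = Word (letters: "'g letter list")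

instantiation word :: (type) monoid_add
begin
definition "0 = Word []"
definition "u + v = Word (letters u @ letters v)"
instance by standard (simp_all add: zero_word_def plus_word_def)
end

definition word_adj :: "'g word \<Rightarrow> 'g word"
  where "word_adj u = Word (rev (map flip (letters u)))"

type_synonym 'g free = "'g word \<Rightarrow>\<^sub>0 complex"

definition scalar :: "complex \<Rightarrow> 'g free"
  where "scalar c = Poly_Mapping.single 0 c"

definition gen :: "'g \<Rightarrow> 'g free"
  where "gen g = Poly_Mapping.single (Word [Gen g]) 1"

text \<open>The coefficient of \<open>u\<close> in \<open>p\<^sup>*\<close> is the conjugate of the coefficient of \<open>u\<^sup>*\<close> in \<open>p\<close>.\<close>

definition adj :: "'g free \<Rightarrow> 'g free"
  where "adj p = Poly_Mapping.map cnj (Poly_Mapping.map_key word_adj p)"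

definition free_ring :: "'g free ring"
  where "free_ring = \<lparr>carrier = UNIV, mult = (*), one = 1, zero = 0, add = (+)\<rparr>"

section \<open>Unital *-algebras given by generators and relations\<close>

text \<open>A pair \<open>(l, r)\<close> stands for the relation \<open>l = r\<close>. The ideal is closed under \<^const>\<open>adj\<close>
  because the adjoint of every relation is imposed as well; it is closed under scalars because
  these belong to the free algebra.\<close>

definition rel_ideal :: "('g free \<times> 'g free) set \<Rightarrow> 'g free set"
  where "rel_ideal S =
    Idl\<^bsub>free_ring\<^esub> ((\<lambda>(l, r). l - r) ` S \<union> (\<lambda>(l, r). adj (l - r)) ` S)"

definition cls :: "('g free \<times> 'g free) set \<Rightarrow> 'g free \<Rightarrow> 'g free set"
  where "cls S p = rel_ideal S +>\<^bsub>free_ring\<^esub> p"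

definition presented :: "('g free \<times> 'g free) set \<Rightarrow> 'g free set star_alg"
  where "presented S = (let Q = free_ring Quot rel_ideal S in
    \<lparr>carrier = carrier Q, mult = mult Q, one = one Q, zero = zero Q, add = add Q,
     smult = (\<lambda>c P. cls S (scalar c) \<otimes>\<^bsub>Q\<^esub> P), star = image adj\<rparr>)"

subsection \<open>Presented algebras are *-algebras\<close>

lemma free_ring_simps [simp]:
  "carrier free_ring = UNIV" "mult free_ring = (*)" "one free_ring = 1"
  "zero free_ring = 0" "add free_ring = (+)"
  by (simp_all add: free_ring_def)

lemma ring_free_ring: "ring (free_ring :: 'g free ring)"
proof (rule ringI)
  show "abelian_group (free_ring :: 'g free ring)"
    by (rule abelian_groupI) (auto simp: algebra_simps intro: exI[of _ "- x" for x] add.left_inverse)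
  show "Group.monoid (free_ring :: 'g free ring)"
    by (rule Group.monoidI) (auto simp: algebra_simps)
qed (auto simp: algebra_simps)

lemma flip_flip [simp]: "flip (flip l) = l"
  by (cases l) auto

lemma word_adj_word_adj [simp]: "word_adj (word_adj u) = u"
  by (cases u) (simp add: word_adj_def rev_map comp_def)

lemma word_adj_plus: "word_adj (u + v) = word_adj v + word_adj u"
  by (simp add: word_adj_def plus_word_def)

lemma word_adj_zero [simp]: "word_adj 0 = 0"
  by (simp add: word_adj_def zero_word_def)

lemma inj_word_adj: "inj word_adj"
  by (metis injI word_adj_word_adj)

lemma lookup_adj: "Poly_Mapping.lookup (adj p) u = cnj (Poly_Mapping.lookup p (word_adj u))"
  by (simp add: adj_def Poly_Mapping.map.rep_eq map_key.rep_eq inj_word_adj when_def)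

lemma adj_single: "adj (Poly_Mapping.single u c) = Poly_Mapping.single (word_adj u) (cnj c)"
  by (rule poly_mapping_eqI) (auto simp: lookup_adj lookup_single when_def)

lemma adj_adj [simp]: "adj (adj p) = p"
  by (rule poly_mapping_eqI) (simp add: lookup_adj)

lemma adj_add: "adj (p + q) = adj p + adj q"
  by (rule poly_mapping_eqI) (simp add: lookup_adj lookup_add)

lemma adj_zero [simp]: "adj 0 = 0"
  by (rule poly_mapping_eqI) (simp add: lookup_adj)

lemma adj_diff: "adj (p - q) = adj p - adj q"
  by (rule poly_mapping_eqI) (simp add: lookup_adj lookup_minus)

lemma free_induct [case_names single add]:
  fixes p :: "'g free"
  assumes "\<And>u c. P (Poly_Mapping.single u c)" "\<And>p q. P p \<Longrightarrow> P q \<Longrightarrow> P (p + q)"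
  shows "P p"
proof -
  have "P (\<Sum>u\<in>A. Poly_Mapping.single u (Poly_Mapping.lookup p u))" if "finite A" for A
    using that by induction (use assms(1)[of 0 0] assms in auto)
  moreover have "p = (\<Sum>u\<in>Poly_Mapping.keys p. Poly_Mapping.single u (Poly_Mapping.lookup p u))"
    by (rule poly_mapping_eqI) (auto simp: lookup_sum lookup_single when_def in_keys_iff)
  ultimately show ?thesis
    by (metis finite_keys)
qed

lemma adj_mult: "adj (p * q) = adj q * adj p"
proof (induction p rule: free_induct)
  case (single u c)
  show ?case
    by (induction q rule: free_induct)
      (simp_all add: mult_single adj_single word_adj_plus distrib_left distrib_right adj_add mult.commute)
qed (simp add: distrib_left distrib_right adj_add)

lemma adj_scalar [simp]: "adj (scalar c) = scalar (cnj c)"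
  by (simp add: scalar_def adj_single)

lemma scalar_central: "scalar c * p = p * scalar c"
  by (induction p rule: free_induct)
    (simp_all add: scalar_def mult_single distrib_left distrib_right mult.commute)


lemma scalar_add: "scalar (c + d) = scalar c + scalar d"
  by (simp add: scalar_def single_add)

lemma scalar_mult: "scalar (c * d) = scalar c * scalar d"
  by (simp add: scalar_def mult_single)

lemma scalar_one [simp]: "scalar 1 = 1"
  by (simp add: scalar_def)

lemma ideal_rel_ideal: "ideal (rel_ideal S) free_ring"
  unfolding rel_ideal_def by (rule ring.genideal_ideal[OF ring_free_ring]) simp

lemma adj_rel_ideal: "p \<in> rel_ideal S \<Longrightarrow> adj p \<in> rel_ideal S"
proof -
  interpret I: ideal "rel_ideal S" free_ring by (rule ideal_rel_ideal)
  let ?G = "(\<lambda>(l, r). l - r) ` S \<union> (\<lambda>(l, r). adj (l - r)) ` S"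
  let ?J = "adj -` rel_ideal S"
  have add: "p + q \<in> rel_ideal S" if "p \<in> rel_ideal S" "q \<in> rel_ideal S" for p q
    using additive_subgroup.a_closed[OF ideal.axioms(1)[OF ideal_rel_ideal] that] by simp
  have left: "p * q \<in> rel_ideal S" if "q \<in> rel_ideal S" for p q
    using I.I_l_closed[OF that, of p] by simp
  have right: "q * p \<in> rel_ideal S" if "q \<in> rel_ideal S" for p q
    using I.I_r_closed[OF that, of p] by simp
  have zero: "0 \<in> rel_ideal S"
    using additive_subgroup.zero_closed[OF ideal.axioms(1)[OF ideal_rel_ideal]] by simp
  have minus: "- p \<in> rel_ideal S" if "p \<in> rel_ideal S" for p
    using left[OF that, of "- 1"] by simp
  have "ideal ?J free_ring"
  proof (rule idealI[OF ring_free_ring])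
    show "subgroup ?J (add_monoid free_ring)"
    proof
      fix p :: "'a free"
      assume p: "p \<in> ?J"
      have "inv\<^bsub>add_monoid free_ring\<^esub> p = - p"
        by (rule group.inv_equality[OF abelian_group.a_group])
          (use ring_free_ring in \<open>auto simp: ring_def\<close>)
      moreover have "adj (- p) = - adj p"
        using adj_diff[of 0 p] by simp
      ultimately show "inv\<^bsub>add_monoid free_ring\<^esub> p \<in> ?J"
        using p minus by simp
    qed (auto simp: adj_add add zero)
  qed (auto simp: adj_mult left right)
  moreover have "?G \<subseteq> ?J"
  proof -
    have "?G \<subseteq> rel_ideal S"
      unfolding rel_ideal_def by (rule ring.genideal_self[OF ring_free_ring]) simp
    then show ?thesis by (fastforce simp: image_subset_iff)
  qed
  ultimately have "rel_ideal S \<subseteq> ?J"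
    unfolding rel_ideal_def by (rule ring.genideal_minimal[OF ring_free_ring])
  then show "p \<in> rel_ideal S \<Longrightarrow> adj p \<in> rel_ideal S" by blast
qed

lemma cls_eq: "cls S p = {i + p | i. i \<in> rel_ideal S}"
  by (auto simp: cls_def a_r_coset_def r_coset_def)

lemma carrier_presented: "carrier (presented S) = range (cls S)"
  by (auto simp: presented_def Let_def FactRing_def A_RCOSETS_def RCOSETS_def cls_def
      a_r_coset_def)

lemma cls_add: "cls S p \<oplus>\<^bsub>presented S\<^esub> cls S q = cls S (p + q)"
  using abelian_subgroup.a_rcos_sum[OF
      abelian_subgroupI3[OF ideal.axioms(1)[OF ideal_rel_ideal] ring.is_abelian_group[OF ring_free_ring]],
      of p q S]
  by (simp add: presented_def Let_def FactRing_def cls_def)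

lemma cls_mult: "cls S p \<otimes>\<^bsub>presented S\<^esub> cls S q = cls S (p * q)"
  using ideal.rcoset_mult_add[OF ideal_rel_ideal, of p q S]
  by (simp add: presented_def Let_def FactRing_def cls_def)

lemma cls_one: "\<one>\<^bsub>presented S\<^esub> = cls S 1"
  by (simp add: presented_def Let_def FactRing_def cls_def)

lemma cls_zero: "\<zero>\<^bsub>presented S\<^esub> = cls S 0"
  by (simp add: presented_def Let_def FactRing_def cls_eq)

lemma cls_smult: "c \<odot>\<^bsub>presented S\<^esub> cls S p = cls S (scalar c * p)"
  using cls_mult[of S "scalar c" p] by (simp add: presented_def Let_def)

lemma star_cls: "star (presented S) (cls S p) = cls S (adj p)"
proof -
  have "adj ` cls S p = cls S (adj p)"
  proof (intro equalityI subsetI)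
    fix q assume "q \<in> cls S (adj p)"
    then obtain i where "i \<in> rel_ideal S" "q = i + adj p"
      by (auto simp: cls_eq)
    then have "q = adj (adj i + p)" "adj i + p \<in> cls S p"
      by (auto simp: cls_eq adj_add adj_rel_ideal)
    then show "q \<in> adj ` cls S p" by blast
  qed (auto simp: cls_eq adj_add adj_rel_ideal)
  then show ?thesis by (simp add: presented_def Let_def)
qed

lemma star_algebra_presented: "star_algebra (presented S)"
proof -
  have "abelian_group (presented S)"
  proof (rule abelian_groupI)
    fix P
    assume "P \<in> carrier (presented S)"
    then obtain p where "P = cls S p"
      by (auto simp: carrier_presented)
    then show "\<exists>Q\<in>carrier (presented S). Q \<oplus>\<^bsub>presented S\<^esub> P = \<zero>\<^bsub>presented S\<^esub>"
      by (intro bexI[of _ "cls S (- p)"]) (auto simp: carrier_presented cls_add cls_zero)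
  qed (auto simp: carrier_presented cls_add cls_zero algebra_simps)
  moreover have "Group.monoid (presented S)"
    by (rule Group.monoidI) (auto simp: carrier_presented cls_mult cls_one mult.assoc)
  ultimately have "ring (presented S)"
    by (rule ringI) (auto simp: carrier_presented cls_add cls_mult distrib_left distrib_right)
  moreover have "star_algebra_axioms (presented S)"
  proof
    fix x y :: "'a free set" and c :: complex
    assume "x \<in> carrier (presented S)" "y \<in> carrier (presented S)"
    then obtain p q where xy: "x = cls S p" "y = cls S q"
      unfolding carrier_presented by blast
    have "p * (scalar c * q) = scalar c * (p * q)"
      by (metis mult.assoc scalar_central)
    then show "x \<otimes>\<^bsub>presented S\<^esub> (c \<odot>\<^bsub>presented S\<^esub> y) = c \<odot>\<^bsub>presented S\<^esub> (x \<otimes>\<^bsub>presented S\<^esub> y)"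
      by (simp add: xy cls_mult cls_smult)
    show "star (presented S) (c \<odot>\<^bsub>presented S\<^esub> x) = cnj c \<odot>\<^bsub>presented S\<^esub> star (presented S) x"
      by (simp add: xy cls_smult star_cls adj_mult scalar_central)
  qed (auto simp: carrier_presented cls_add cls_mult cls_smult star_cls adj_add adj_mult
      scalar_add scalar_mult distrib_left distrib_right mult.assoc)
  ultimately show ?thesis
    by (rule star_algebra.intro)
qed

section \<open>The deformed four-sphere and projective space\<close>

definition selfadjoint :: "'g free \<Rightarrow> ('g free \<times> 'g free) set"
  where "selfadjoint p = {(adj p, p)}"

definition normal_elt :: "'g free \<Rightarrow> ('g free \<times> 'g free) set"
  where "normal_elt p = {(p * adj p, adj p * p)}"

definition central :: "'g free \<Rightarrow> ('g free \<times> 'g free) set"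
  where "central p = (\<Union>g. {(p * gen g, gen g * p), (p * adj (gen g), adj (gen g) * p)})"

text \<open>Commutation \<open>p q = \<lambda> q p\<close> together with its versions for one factor replaced by its adjoint.\<close>

definition qcomm :: "complex \<Rightarrow> 'g free \<Rightarrow> 'g free \<Rightarrow> ('g free \<times> 'g free) set"
  where "qcomm l p q =
    {(p * q, scalar l * q * p),
     (p * adj q, scalar (inverse l) * adj q * p),
     (adj p * q, scalar (inverse l) * q * adj p)}"

datatype S4_gen = S4_a | S4_z | S4_w

definition S4_rels :: "real \<Rightarrow> (S4_gen free \<times> S4_gen free) set"
  where "S4_rels \<theta> = (let a = gen S4_a; z = gen S4_z; w = gen S4_w in
    selfadjoint a \<union> central a \<union> normal_elt z \<union> normal_elt w \<union>
    {(z * w, scalar (cis (- \<theta>)) * w * z),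
     (z * adj w, scalar (cis \<theta>) * adj w * z),
     (adj z * z + adj w * w, a * (1 - a))})"

definition S4_alg :: "real \<Rightarrow> S4_gen free set star_alg"
  where "S4_alg \<theta> = presented (S4_rels \<theta>)"

definition S4_el :: "real \<Rightarrow> S4_gen \<Rightarrow> S4_gen free set"
  where "S4_el \<theta> g = cls (S4_rels \<theta>) (gen g)"

text \<open>The generators are the entries on and above the diagonal of the self-adjoint matrix
  with rows \<open>(a, x, y, z)\<close>, \<open>(x\<^sup>*, b, w, v)\<close>, \<open>(y\<^sup>*, w\<^sup>*, c, u)\<close>, \<open>(z\<^sup>*, v\<^sup>*, u\<^sup>*, d)\<close>;
  the remaining entries are their adjoints.\<close>

datatype CP3_gen =
  CP3_a | CP3_b | CP3_c | CP3_d | CP3_x | CP3_y | CP3_z | CP3_u | CP3_v | CP3_w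

definition CP3_rels :: "real \<Rightarrow> (CP3_gen free \<times> CP3_gen free) set"
  where "CP3_rels \<theta> = (let
      a = gen CP3_a; b = gen CP3_b; c = gen CP3_c; d = gen CP3_d;
      x = gen CP3_x; y = gen CP3_y; z = gen CP3_z;
      u = gen CP3_u; v = gen CP3_v; w = gen CP3_w in
    (\<Union>p\<in>{a, b, c, d}. selfadjoint p \<union> central p) \<union>
    (\<Union>p\<in>{x, y, z, u, v, w}. normal_elt p) \<union>
    {(a + b + c + d, 1)} \<union>
    {(adj x * x, a * b), (adj y * y, a * c), (adj z * z, a * d),
     (adj u * u, c * d), (adj v * v, b * d), (adj w * w, b * c)} \<union>
    {(a * u, adj y * z), (a * v, adj x * z), (a * w, adj x * y),
     (b * u, adj w * v), (c * v, w * u), (d * w, v * adj u),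
     (c * x, y * adj w), (b * y, x * w), (b * z, x * v),
     (d * x, z * adj v), (d * y, z * adj u), (c * z, y * u)} \<union>
    qcomm (cis \<theta>) x z \<union> qcomm (cis \<theta>) y x \<union> qcomm (cis \<theta>) y z \<union>
    qcomm (cis \<theta>) u v \<union> qcomm (cis \<theta>) u w \<union> qcomm (cis \<theta>) v w \<union>
    qcomm (cis (2 * \<theta>)) x u \<union> qcomm (cis \<theta>) x v \<union> qcomm (cis (- \<theta>)) x w \<union>
    qcomm (cis \<theta>) y u \<union> qcomm 1 y v \<union> qcomm (cis (- \<theta>)) y w \<union>
    qcomm (cis \<theta>) z u \<union> qcomm (cis \<theta>) z v \<union> qcomm 1 z w)"

definition CP3_alg :: "real \<Rightarrow> CP3_gen free set star_alg"
  where "CP3_alg \<theta> = presented (CP3_rels \<theta>)"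

definition CP3_el :: "real \<Rightarrow> CP3_gen \<Rightarrow> CP3_gen free set"
  where "CP3_el \<theta> g = cls (CP3_rels \<theta>) (gen g)"

end

theory Submission
  imports Defs
begin

text \<open>The only relation of the sphere that does not follow at once from the commutation relations is
  the last one, whose cross terms cancel because \<open>z w = e\<^sup>i\<^sup>\<theta> v y\<close>. This holds after multiplication by each
  of \<open>a, b, c, d\<close>, hence outright since these sum to \<open>1\<close>.

  For injectivity, eliminating \<open>w\<^sup>* w\<close> shows that the sphere algebra is spanned by the monomials
  \<open>a\<^sup>i z\<^sup>j (z\<^sup>*)\<^sup>k w\<^sub>l\<close>, where \<open>w\<^sub>l\<close> is a power of \<open>w\<close> or of \<open>w\<^sup>*\<close> according to the sign of \<open>l\<close>. The algebra of
  projective space acts by weighted shifts with two free parameters (a quantum torus with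
  polynomial coefficients). There the images of the monomials have bidegree \<open>(j - k, l)\<close>, and those of
  equal bidegree are proportional to the distinct monomials \<open>s\<^sup>i P\<^sup>k\<close> in independent parameters
  \<open>s, P\<close>, so all of them are linearly independent.\<close>

section \<open>Congruence modulo the relations\<close>

definition eqv :: "('g free \<times> 'g free) set \<Rightarrow> 'g free \<Rightarrow> 'g free \<Rightarrow> bool"
  where "eqv S p q \<longleftrightarrow> p - q \<in> rel_ideal S"

lemma rel_ideal_zero: "0 \<in> rel_ideal S"
  using additive_subgroup.zero_closed[OF ideal.axioms(1)[OF ideal_rel_ideal]] by simp

lemma rel_ideal_add: "p \<in> rel_ideal S \<Longrightarrow> q \<in> rel_ideal S \<Longrightarrow> p + q \<in> rel_ideal S"
  using additive_subgroup.a_closed[OF ideal.axioms(1)[OF ideal_rel_ideal], of p S q] by simp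

lemma rel_ideal_left: "q \<in> rel_ideal S \<Longrightarrow> p * q \<in> rel_ideal S"
  using ideal.I_l_closed[OF ideal_rel_ideal, of q S p] by simp

lemma rel_ideal_right: "q \<in> rel_ideal S \<Longrightarrow> q * p \<in> rel_ideal S"
  using ideal.I_r_closed[OF ideal_rel_ideal, of q S p] by simp

lemma rel_ideal_uminus: "p \<in> rel_ideal S \<Longrightarrow> - p \<in> rel_ideal S"
  using rel_ideal_left[of p S "- 1"] by simp

text \<open>Serves to show that all of \<open>rel_ideal S\<close> is mapped into an ideal or acts by
  zero. Negatives are obtained by left multiplication by \<open>- 1\<close>.\<close>

lemma rel_ideal_minimal:
  assumes zero: "0 \<in> J" and add: "\<And>p q. p \<in> J \<Longrightarrow> q \<in> J \<Longrightarrow> p + q \<in> J"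
    and left: "\<And>p q. q \<in> J \<Longrightarrow> p * q \<in> J" and right: "\<And>p q. q \<in> J \<Longrightarrow> q * p \<in> J"
    and rels: "\<And>l r. (l, r) \<in> S \<Longrightarrow> l - r \<in> J" "\<And>l r. (l, r) \<in> S \<Longrightarrow> adj (l - r) \<in> J"
  shows "rel_ideal S \<subseteq> J"
proof -
  have "ideal J free_ring"
  proof (rule idealI[OF ring_free_ring])
    show "subgroup J (add_monoid free_ring)"
    proof
      fix p :: "'a free"
      assume p: "p \<in> J"
      have "inv\<^bsub>add_monoid free_ring\<^esub> p = - p"
        by (rule group.inv_equality[OF abelian_group.a_group])
          (use ring_free_ring in \<open>auto simp: ring_def\<close>)
      then show "inv\<^bsub>add_monoid free_ring\<^esub> p \<in> J"
        using left[OF p, of "- 1"] by simp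
    qed (auto simp: add zero)
  qed (auto simp: left right)
  then show ?thesis
    unfolding rel_ideal_def
    by (rule ring.genideal_minimal[OF ring_free_ring]) (auto dest: rels)
qed

lemma eqv_rel: "(p, q) \<in> S \<Longrightarrow> eqv S p q"
  unfolding eqv_def rel_ideal_def
  by (rule subsetD[OF ring.genideal_self[OF ring_free_ring]]) force+

lemma eqv_refl [simp, intro]: "eqv S p p"
  by (simp add: eqv_def rel_ideal_zero)

lemma eqv_sym: "eqv S p q \<Longrightarrow> eqv S q p"
  using rel_ideal_uminus[of "p - q" S] by (simp add: eqv_def)

lemma eqv_trans [trans]: "eqv S p q \<Longrightarrow> eqv S q r \<Longrightarrow> eqv S p r"
  using rel_ideal_add[of "p - q" S "q - r"] by (simp add: eqv_def)

lemma eqv_add: "eqv S p q \<Longrightarrow> eqv S p' q' \<Longrightarrow> eqv S (p + p') (q + q')"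
  using rel_ideal_add[of "p - q" S "p' - q'"] by (simp add: eqv_def algebra_simps)

lemma eqv_uminus: "eqv S p q \<Longrightarrow> eqv S (- p) (- q)"
  using rel_ideal_uminus[of "p - q" S] by (simp add: eqv_def)

lemma eqv_diff: "eqv S p q \<Longrightarrow> eqv S p' q' \<Longrightarrow> eqv S (p - p') (q - q')"
  using eqv_add[OF _ eqv_uminus, of S p q p' q'] by simp

lemma eqv_left: "eqv S p q \<Longrightarrow> eqv S (r * p) (r * q)"
  using rel_ideal_left[of "p - q" S r] by (simp add: eqv_def algebra_simps)

lemma eqv_right: "eqv S p q \<Longrightarrow> eqv S (p * r) (q * r)"
  using rel_ideal_right[of "p - q" S r] by (simp add: eqv_def algebra_simps)

lemma eqv_adj: "eqv S p q \<Longrightarrow> eqv S (adj p) (adj q)"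
  using adj_rel_ideal[of "p - q" S] by (simp add: eqv_def adj_diff)

lemma cls_eq_iff: "cls S p = cls S q \<longleftrightarrow> eqv S p q"
proof
  assume "cls S p = cls S q"
  then have "p \<in> cls S q"
    using rel_ideal_zero[of S] by (force simp: cls_eq)
  then show "eqv S p q" by (auto simp: cls_eq eqv_def)
next
  have "cls S p \<subseteq> cls S q" if e: "eqv S p q" for p q
  proof
    fix r assume "r \<in> cls S p"
    then obtain i where "i \<in> rel_ideal S" "r = i + p" by (auto simp: cls_eq)
    then have "i + (p - q) \<in> rel_ideal S" "r = (i + (p - q)) + q"
      using e by (auto simp: eqv_def rel_ideal_add)
    then show "r \<in> cls S q" unfolding cls_eq by blast
  qed
  then show "eqv S p q \<Longrightarrow> cls S p = cls S q" by (blast intro: eqv_sym)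
qed

text \<open>A derived congruence, in contrast to \<open>qcomm\<close>, which is a set of imposed
  relations. With \<open>l = 1\<close> it also covers centrality and normality.\<close>

definition qc :: "('g free \<times> 'g free) set \<Rightarrow> complex \<Rightarrow> 'g free \<Rightarrow> 'g free \<Rightarrow> bool"
  where "qc S l p q \<longleftrightarrow> eqv S (p * q) (scalar l * (q * p))"

lemma scalar_left_commute: "p * (scalar c * q) = scalar c * (p * q)"
  by (metis mult.assoc scalar_central)

lemma scalar_zero [simp]: "scalar 0 = 0"
  by (simp add: scalar_def)

lemma scalar_scalar: "scalar c * (scalar d * p) = scalar (c * d) * p"
  by (simp add: scalar_mult mult.assoc)

lemma qc_sym: "qc S l p q \<Longrightarrow> l \<noteq> 0 \<Longrightarrow> qc S (inverse l) q p"
  unfolding qc_def using eqv_sym[OF eqv_left[of S "p * q" "scalar l * (q * p)" "scalar (inverse l)"]]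
  by (simp add: scalar_scalar)

lemma qc_adj: "qc S l p q \<Longrightarrow> qc S (cnj l) (adj q) (adj p)"
  unfolding qc_def by (drule eqv_adj) (simp add: adj_mult scalar_central)

lemma qc_add_left: "qc S l p r \<Longrightarrow> qc S l q r \<Longrightarrow> qc S l (p + q) r"
  unfolding qc_def by (drule (1) eqv_add) (simp add: distrib_left distrib_right)

lemma qc_add_right: "qc S l r p \<Longrightarrow> qc S l r q \<Longrightarrow> qc S l r (p + q)"
  unfolding qc_def by (drule (1) eqv_add) (simp add: distrib_left distrib_right)

lemma qc_diff_left: "qc S l p r \<Longrightarrow> qc S l q r \<Longrightarrow> qc S l (p - q) r"
  unfolding qc_def by (drule (1) eqv_diff) (simp add: left_diff_distrib right_diff_distrib)

lemma qc_diff_right: "qc S l r p \<Longrightarrow> qc S l r q \<Longrightarrow> qc S l r (p - q)"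
  unfolding qc_def by (drule (1) eqv_diff) (simp add: left_diff_distrib right_diff_distrib)

lemma qc_scalar_left: "qc S l p q \<Longrightarrow> qc S l (scalar c * p) q"
  unfolding qc_def
  by (drule eqv_left[of _ _ _ "scalar c"])
    (simp add: mult.assoc scalar_left_commute[of q] scalar_scalar mult.commute[of c])

lemma qc_scalar_right: "qc S l p q \<Longrightarrow> qc S l p (scalar c * q)"
  unfolding qc_def
  by (drule eqv_left[of _ _ _ "scalar c"])
    (simp add: mult.assoc scalar_left_commute[of p] scalar_scalar mult.commute[of c])

lemma qc_one [simp]: "qc S 1 p 1"
  by (simp add: qc_def)

lemma qc_mult: "qc S l p q \<Longrightarrow> qc S m p r \<Longrightarrow> qc S (l * m) p (q * r)"
proof -
  assume q: "qc S l p q" and r: "qc S m p r"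
  have "eqv S (p * (q * r)) (scalar l * (q * (p * r)))"
    using eqv_right[OF q[unfolded qc_def], of r] by (simp add: mult.assoc)
  also have "eqv S (scalar l * (q * (p * r))) (scalar l * (q * (scalar m * (r * p))))"
    using r unfolding qc_def by (intro eqv_left)
  finally show ?thesis
    by (simp add: qc_def scalar_left_commute[of q] scalar_scalar mult.assoc)
qed

lemma qc_power: "qc S l p q \<Longrightarrow> qc S (l ^ n) p (q ^ n)"
  by (induction n) (auto intro: qc_mult)

lemma qc_1_commute: "qc S 1 p q \<longleftrightarrow> eqv S (p * q) (q * p)"
  by (simp add: qc_def)

lemma qc_refl [simp]: "qc S 1 p p"
  by (simp add: qc_def)

lemma inverse_norm_1: "cmod l = 1 \<Longrightarrow> inverse l = cnj l"
  by (simp add: inverse_eq_divide complex_div_cnj[of 1])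

lemma qc_swap: "qc S l p q \<Longrightarrow> cmod l = 1 \<Longrightarrow> qc S (cnj l) q p"
  using qc_sym[of S l p q] inverse_norm_1[of l] by fastforce

text \<open>The fourth claim is not a defining relation: taking adjoints reverses the factors and
  conjugates the phase, and swapping back conjugates it again because \<open>l\<close> has modulus
  one.\<close>

lemma qc_qcomm:
  assumes "qcomm l p q \<subseteq> S" "cmod l = 1"
  shows "qc S l p q" "qc S (cnj l) p (adj q)" "qc S (cnj l) (adj p) q" "qc S l (adj p) (adj q)"
proof -
  show 1: "qc S l p q" and "qc S (cnj l) p (adj q)" "qc S (cnj l) (adj p) q"
    using assms unfolding qcomm_def qc_def
    by (auto intro!: eqv_rel simp: mult.assoc inverse_norm_1)
  show "qc S l (adj p) (adj q)"
    using qc_swap[OF qc_adj[OF 1]] assms(2) by simp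
qed

lemma qc_qcomm_swap:
  assumes "qcomm l p q \<subseteq> S" "cmod l = 1"
  shows "qc S (cnj l) q p" "qc S l (adj q) p" "qc S l q (adj p)" "qc S (cnj l) (adj q) (adj p)"
  using qc_qcomm[OF assms, THEN qc_swap] assms(2) by simp_all

lemma qc_left: "qc S l p q \<Longrightarrow> eqv S (p * (q * r)) (scalar l * (q * (p * r)))"
  unfolding qc_def by (drule eqv_right[of _ _ _ r]) (simp add: mult.assoc)

section \<open>Evaluation of the free algebra\<close>

definition ev :: "('g \<Rightarrow> 'h free) \<Rightarrow> 'g free \<Rightarrow> 'h free"
  where "ev h p = (\<Sum>u\<in>Poly_Mapping.keys p. scalar (Poly_Mapping.lookup p u) *
    (\<Prod>l\<leftarrow>letters u. case l of Gen g \<Rightarrow> h g | Adj g \<Rightarrow> adj (h g)))"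

lemma ev_single: "ev h (Poly_Mapping.single u c) =
    scalar c * (\<Prod>l\<leftarrow>letters u. case l of Gen g \<Rightarrow> h g | Adj g \<Rightarrow> adj (h g))"
  by (cases "c = 0") (simp_all add: ev_def)

lemma ev_add: "ev h (p + q) = ev h p + ev h q"
  unfolding ev_def by (rule setsum_keys_plus_distrib) (simp_all add: scalar_add distrib_right)

lemma ev_zero [simp]: "ev h 0 = 0"
  by (simp add: ev_def)

lemma ev_scalar [simp]: "ev h (scalar c) = scalar c"
  by (simp add: scalar_def[of c] ev_single zero_word_def)

lemma ev_one [simp]: "ev h 1 = 1"
  using ev_scalar[of h 1] by simp

lemma ev_gen [simp]: "ev h (gen g) = h g"
  by (simp add: gen_def ev_single)

lemma ev_mult: "ev h (p * q) = ev h p * ev h q"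
proof (induction p rule: free_induct)
  case (single u c)
  show ?case
    by (induction q rule: free_induct)
      (simp_all add: mult_single ev_single ev_add distrib_left plus_word_def scalar_mult
        scalar_left_commute[of "prod_list _"] mult.assoc)
qed (simp add: distrib_right ev_add)

lemma ev_uminus: "ev h (- p) = - ev h p"
  using ev_add[of h p "- p"] by (simp add: eq_neg_iff_add_eq_0 add.commute)

lemma ev_diff: "ev h (p - q) = ev h p - ev h q"
  using ev_add[of h p "- q"] by (simp add: ev_uminus)

lemma ev_power: "ev h (p ^ n) = ev h p ^ n"
  by (induction n) (simp_all add: ev_mult)

lemma adj_one [simp]: "adj 1 = 1"
  using adj_scalar[of 1] by simp

lemma adj_prod_list: "adj (prod_list ps) = prod_list (rev (map adj ps))"
  by (induction ps) (simp_all add: adj_mult)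

lemma ev_adj: "ev h (adj p) = adj (ev h p)"
proof (induction p rule: free_induct)
  case (single u c)
  have *: "(case flip l of Gen g \<Rightarrow> h g | Adj g \<Rightarrow> adj (h g)) =
      adj (case l of Gen g \<Rightarrow> h g | Adj g \<Rightarrow> adj (h g))" for l
    by (cases l) auto
  show ?case
    by (simp add: adj_single ev_single word_adj_def rev_map[symmetric] adj_mult adj_prod_list
        scalar_central comp_def *)
qed (simp add: adj_add ev_add)

text \<open>The preimage of \<open>rel_ideal T\<close> under \<open>ev h\<close> is a two-sided
  ideal. It contains the adjoint relations too, since \<open>ev h\<close> commutes with
  \<open>adj\<close> and \<open>rel_ideal T\<close> is closed under \<open>adj\<close>.\<close>

lemma ev_rel_ideal:
  assumes "\<And>l r. (l, r) \<in> S \<Longrightarrow> eqv T (ev h l) (ev h r)" and "p \<in> rel_ideal S"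
  shows "ev h p \<in> rel_ideal T"
proof -
  have "rel_ideal S \<subseteq> {p. ev h p \<in> rel_ideal T}"
    by (rule rel_ideal_minimal)
      (use assms(1) in \<open>auto simp: rel_ideal_zero ev_add ev_mult ev_diff ev_adj rel_ideal_add
        rel_ideal_left rel_ideal_right eqv_def intro: adj_rel_ideal\<close>)
  then show ?thesis using assms(2) by blast
qed


section \<open>The homomorphism on generators\<close>

definition eta_gen :: "real \<Rightarrow> S4_gen \<Rightarrow> CP3_gen free"
  where "eta_gen \<theta> g = (case g of
      S4_a \<Rightarrow> gen CP3_a + gen CP3_b
    | S4_z \<Rightarrow> scalar (cis \<theta>) * gen CP3_y + adj (gen CP3_v)
    | S4_w \<Rightarrow> gen CP3_w - adj (gen CP3_z))"

locale deformed_CP3 =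
  fixes \<theta> :: real
begin

abbreviation (input) CP3_eqv (infix "\<approx>" 50) where "p \<approx> q \<equiv> eqv (CP3_rels \<theta>) p q"

abbreviation (input) "a \<equiv> gen CP3_a"
abbreviation (input) "b \<equiv> gen CP3_b"
abbreviation (input) "c \<equiv> gen CP3_c"
abbreviation (input) "d \<equiv> gen CP3_d"
abbreviation (input) "x \<equiv> gen CP3_x"
abbreviation (input) "y \<equiv> gen CP3_y"
abbreviation (input) "z \<equiv> gen CP3_z"
abbreviation (input) "u \<equiv> gen CP3_u"
abbreviation (input) "v \<equiv> gen CP3_v"
abbreviation (input) "w \<equiv> gen CP3_w"

section \<open>Relations of projective space as congruences\<close>

lemma CP3_diagonal:
  assumes "p \<in> {a, b, c, d}"
  shows "adj p \<approx> p" "p * gen g \<approx> gen g * p" "p * adj (gen g) \<approx> adj (gen g) * p"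
proof -
  have "selfadjoint p \<union> central p \<subseteq> CP3_rels \<theta>"
    using assms unfolding CP3_rels_def Let_def by (intro le_supI1 UN_upper)
  then show "adj p \<approx> p" "p * gen g \<approx> gen g * p" "p * adj (gen g) \<approx> adj (gen g) * p"
    by (auto simp: selfadjoint_def central_def intro!: eqv_rel)
qed

lemma CP3_normal:
  assumes "p \<in> {x, y, z, u, v, w}"
  shows "p * adj p \<approx> adj p * p"
proof (rule eqv_rel)
  have "(p * adj p, adj p * p) \<in> (\<Union>p\<in>{x, y, z, u, v, w}. normal_elt p)"
    by (rule UN_I[OF assms]) (simp add: normal_elt_def)
  then show "(p * adj p, adj p * p) \<in> CP3_rels \<theta>"
    by (simp only: CP3_rels_def Let_def Un_iff simp_thms)
qed

lemma CP3_trace: "a + b + c + d \<approx> 1"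
  by (rule eqv_rel) (simp only: CP3_rels_def Let_def Un_iff insert_iff simp_thms)

lemma CP3_squares:
  "adj y * y \<approx> a * c" "adj z * z \<approx> a * d" "adj v * v \<approx> b * d" "adj w * w \<approx> b * c"
  by (rule eqv_rel; simp only: CP3_rels_def Let_def Un_iff insert_iff simp_thms)+

lemma CP3_minors:
  "a * v \<approx> adj x * z" "a * w \<approx> adj x * y" "b * y \<approx> x * w" "b * z \<approx> x * v"
  "c * v \<approx> w * u" "c * z \<approx> y * u" "d * w \<approx> v * adj u" "d * y \<approx> z * adj u"
  by (rule eqv_rel; simp only: CP3_rels_def Let_def Un_iff insert_iff simp_thms)+

lemma CP3_qcomm:
  "qcomm (cis \<theta>) x z \<subseteq> CP3_rels \<theta>" "qcomm (cis \<theta>) y z \<subseteq> CP3_rels \<theta>"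
  "qcomm (cis \<theta>) u w \<subseteq> CP3_rels \<theta>" "qcomm (cis \<theta>) v w \<subseteq> CP3_rels \<theta>"
  "qcomm (cis \<theta>) x v \<subseteq> CP3_rels \<theta>" "qcomm (cis \<theta>) y u \<subseteq> CP3_rels \<theta>"
  "qcomm (cis (- \<theta>)) y w \<subseteq> CP3_rels \<theta>" "qcomm 1 y v \<subseteq> CP3_rels \<theta>"
  "qcomm (cis \<theta>) z v \<subseteq> CP3_rels \<theta>" "qcomm 1 z w \<subseteq> CP3_rels \<theta>"
  by (rule subsetI; simp only: CP3_rels_def Let_def Un_iff simp_thms)+

lemmas CP3_qc =
  CP3_qcomm[THEN qc_qcomm(1), simplified]
  CP3_qcomm[THEN qc_qcomm(2), simplified, simplified cis_cnj minus_minus]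
  CP3_qcomm[THEN qc_qcomm(3), simplified, simplified cis_cnj minus_minus]
  CP3_qcomm[THEN qc_qcomm(4), simplified]

lemmas CP3_qc_swap = CP3_qcomm[THEN qc_qcomm_swap(1), simplified, simplified cis_cnj minus_minus]
  CP3_qcomm[THEN qc_qcomm_swap(2), simplified]
  CP3_qcomm[THEN qc_qcomm_swap(3), simplified]
  CP3_qcomm[THEN qc_qcomm_swap(4), simplified, simplified cis_cnj minus_minus]

text \<open>The diagonal entries act as a partition of unity: adding the four congruences leaves the
  factor \<open>a + b + c + d\<close>, which is 1.\<close>

lemma CP3_localise:
  assumes "a * p \<approx> a * q" "b * p \<approx> b * q" "c * p \<approx> c * q" "d * p \<approx> d * q"
  shows "p \<approx> q"
proof -
  have "(a + b + c + d) * p \<approx> (a + b + c + d) * q"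
    using eqv_add[OF eqv_add[OF eqv_add[OF assms(1,2)] assms(3)] assms(4)]
    by (simp add: distrib_right)
  from eqv_trans[OF eqv_sym[OF eqv_right[OF CP3_trace]] eqv_trans[OF this eqv_right[OF CP3_trace]]]
  show ?thesis by simp
qed

text \<open>A central entry slips past one generator to reach a factor on which a minor relation can
  act.\<close>

lemma CP3_move:
  assumes "p \<in> {a, b, c, d}" "p * q \<approx> r"
  shows "p * (gen g * q) \<approx> gen g * r"
proof -
  have "p * (gen g * q) \<approx> gen g * (p * q)"
    using eqv_right[OF CP3_diagonal(2)[OF assms(1), of g], of q] by (simp add: mult.assoc)
  also have "gen g * (p * q) \<approx> gen g * r"
    using assms(2) by (rule eqv_left)
  finally show ?thesis .
qed

text \<open>A diagonal factor turns \<open>z\<close> or \<open>w\<close> into a product by a minor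
  relation; after reordering, another minor relation collapses a product to a multiple of
  \<open>v\<close> or \<open>y\<close>.\<close>

lemma CP3_cross: "z * w \<approx> scalar (cis \<theta>) * (v * y)"
proof (rule CP3_localise)
  have "a * (z * w) \<approx> z * (adj x * y)"
    by (intro CP3_move CP3_minors) simp
  also have "\<dots> \<approx> scalar (cis \<theta>) * (adj x * (z * y))"
    by (intro qc_left CP3_qc_swap)
  also have "\<dots> \<approx> scalar (cis \<theta>) * ((a * v) * y)"
    using eqv_left[OF eqv_right[OF eqv_sym[OF CP3_minors(1)]]] by (simp add: mult.assoc)
  finally show "a * (z * w) \<approx> a * (scalar (cis \<theta>) * (v * y))"
    by (simp add: scalar_left_commute[of a] mult.assoc)
next
  have "b * (z * w) \<approx> (x * v) * w"
    using eqv_right[OF CP3_minors(4)] by (simp add: mult.assoc)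
  also have "(x * v) * w \<approx> scalar (cis \<theta>) * (v * (x * w))"
    unfolding mult.assoc by (intro qc_left CP3_qc)
  also have "\<dots> \<approx> scalar (cis \<theta>) * (b * (v * y))"
    by (intro eqv_left eqv_sym[OF CP3_move] CP3_minors) simp
  finally show "b * (z * w) \<approx> b * (scalar (cis \<theta>) * (v * y))"
    by (simp add: scalar_left_commute[of b])
next
  \<comment> \<open>Three exchanges are made here: \<open>w\<close> passes \<open>u\<close> and then
    \<open>y\<close> with cancelling phases, and the surviving phase comes from \<open>y\<close>
    passing \<open>u\<close>.\<close>
  have "c * (z * w) \<approx> y * (u * w)"
    using eqv_right[OF CP3_minors(6)] by (simp add: mult.assoc)
  also have "\<dots> \<approx> y * (scalar (cis \<theta>) * (w * u))"
    by (intro eqv_left CP3_qc[unfolded qc_def])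
  also have "\<dots> = scalar (cis \<theta>) * (y * (w * u))"
    by (rule scalar_left_commute)
  also have "\<dots> \<approx> scalar (cis \<theta>) * (scalar (cis (- \<theta>)) * (w * (y * u)))"
    by (intro eqv_left qc_left CP3_qc)
  also have "\<dots> = w * (y * u)"
    by (simp add: scalar_scalar cis_mult)
  also have "\<dots> \<approx> w * (scalar (cis \<theta>) * (u * y))"
    by (intro eqv_left CP3_qc[unfolded qc_def])
  also have "\<dots> = scalar (cis \<theta>) * ((w * u) * y)"
    by (simp add: scalar_left_commute[of w] mult.assoc)
  also have "\<dots> \<approx> scalar (cis \<theta>) * ((c * v) * y)"
    by (intro eqv_left eqv_right eqv_sym[OF CP3_minors(5)])
  finally show "c * (z * w) \<approx> c * (scalar (cis \<theta>) * (v * y))"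
    by (simp add: scalar_left_commute[of c] mult.assoc)
next
  have "d * (z * w) \<approx> z * (v * adj u)"
    by (intro CP3_move CP3_minors) simp
  also have "\<dots> \<approx> scalar (cis \<theta>) * (v * (z * adj u))"
    by (intro qc_left CP3_qc)
  also have "\<dots> \<approx> scalar (cis \<theta>) * (d * (v * y))"
    by (intro eqv_left eqv_sym[OF CP3_move] CP3_minors) simp
  finally show "d * (z * w) \<approx> d * (scalar (cis \<theta>) * (v * y))"
    by (simp add: scalar_left_commute[of d])
qed

text \<open>The squares add up to \<open>(a + b) * (c + d)\<close>, and the trace relation replaces
  \<open>c + d\<close>. The mixed terms are \<open>?e\<close> and \<open>adj ?e\<close>, which
  vanish by \<open>CP3_cross\<close>.\<close>

lemma eta_sphere:
  defines "h \<equiv> eta_gen \<theta>"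
  shows "adj (h S4_z) * h S4_z + adj (h S4_w) * h S4_w \<approx> h S4_a * (1 - h S4_a)"
proof -
  let ?e = "scalar (cis \<theta>) * (v * y) - z * w"
  have e: "?e \<approx> 0"
    using eqv_sym[OF CP3_cross] by (simp add: eqv_def)
  have "adj (h S4_z) * h S4_z + adj (h S4_w) * h S4_w =
      (adj y * y + v * adj v + adj w * w + z * adj z) + ?e + adj ?e"
    by (simp add: h_def eta_gen_def adj_add adj_diff adj_mult algebra_simps
        scalar_left_commute[of "adj y"] scalar_left_commute[of v] scalar_scalar cis_mult
        scalar_central[of _ "adj y"] scalar_central[of _ "adj y * _"] cis_cnj flip: scalar_mult)
  also have "\<dots> \<approx> (a * c + b * d + b * c + a * d) + 0 + adj 0"
    using CP3_squares CP3_normal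
    by (intro eqv_add eqv_adj e) (auto intro: eqv_trans)
  also have "\<dots> = (a + b) * (c + d)"
    by (simp add: algebra_simps)
  also have "\<dots> \<approx> (a + b) * (1 - (a + b))"
    using CP3_trace by (intro eqv_left) (simp add: eqv_def algebra_simps)
  finally show ?thesis by (simp add: h_def eta_gen_def)
qed

text \<open>Apart from self-adjointness and the sphere relation, each relation says that two images
  commute up to a phase. Every summand of one meets every summand of the other with that same phase,
  so \<open>qc\<close> is checked term by term.\<close>

lemma eta_rels:
  assumes "(l, r) \<in> S4_rels \<theta>"
  shows "ev (eta_gen \<theta>) l \<approx> ev (eta_gen \<theta>) r"
proof -
  let ?h = "eta_gen \<theta>"
  have "qc (CP3_rels \<theta>) 1 p (gen g)" "qc (CP3_rels \<theta>) 1 p (adj (gen g))" if "p \<in> {a, b}" for p g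
    using CP3_diagonal(2,3) that by (auto simp: qc_1_commute)
  then have central: "qc (CP3_rels \<theta>) 1 (?h S4_a) (?h g)" "qc (CP3_rels \<theta>) 1 (?h S4_a) (adj (?h g))" for g
    by (cases g; auto simp: eta_gen_def adj_add adj_diff adj_mult scalar_central[symmetric]
      intro!: qc_add_left qc_add_right qc_diff_right qc_scalar_right)+
  have selfadjoint: "adj (?h S4_a) \<approx> ?h S4_a"
    using CP3_diagonal(1) by (auto simp: eta_gen_def adj_add intro!: eqv_add)
  have n: "qc (CP3_rels \<theta>) 1 y (adj y)" "qc (CP3_rels \<theta>) 1 (adj v) v"
    "qc (CP3_rels \<theta>) 1 w (adj w)" "qc (CP3_rels \<theta>) 1 (adj z) z"
    by (simp_all add: qc_1_commute CP3_normal eqv_sym[OF CP3_normal])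
  have normal: "qc (CP3_rels \<theta>) 1 (?h g) (adj (?h g))" if "g \<in> {S4_z, S4_w}" for g
    using that
    by (auto simp: eta_gen_def adj_add adj_diff adj_mult scalar_central[symmetric]
        intro!: qc_add_left qc_add_right qc_diff_left qc_diff_right qc_scalar_left qc_scalar_right
          n CP3_qc CP3_qc_swap)
  have zw: "qc (CP3_rels \<theta>) (cis (- \<theta>)) (?h S4_z) (?h S4_w)"
    "qc (CP3_rels \<theta>) (cis \<theta>) (?h S4_z) (adj (?h S4_w))"
    by (auto simp: eta_gen_def adj_diff
        intro!: qc_add_left qc_diff_right qc_scalar_left CP3_qc CP3_qc_swap)
  show ?thesis
    using assms central selfadjoint normal zw eta_sphere
    by (auto simp: S4_rels_def Let_def selfadjoint_def central_def normal_elt_def qc_def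
        ev_add ev_mult ev_diff ev_adj mult.assoc)
qed

end


section \<open>A spanning set for the four-sphere\<close>

text \<open>Negative exponents stand for powers of the adjoint, not for inverses; adjacent letters
  of opposite kind are removed by the sphere relation instead of cancelling.\<close>

definition wpow :: "int \<Rightarrow> S4_gen free"
  where "wpow l = (if l \<ge> 0 then gen S4_w ^ nat l else adj (gen S4_w) ^ nat (- l))"

fun S4_mono :: "nat \<times> nat \<times> nat \<times> int \<Rightarrow> S4_gen free"
  where "S4_mono (i, j, k, l) =
    (gen S4_a ^ i * (gen S4_z ^ j * adj (gen S4_z) ^ k)) * wpow l"

text \<open>The linear span of the monomials modulo the relations. Building in the congruence avoids
  explicit coefficients while rewriting.\<close>

inductive spanned :: "real \<Rightarrow> S4_gen free \<Rightarrow> bool" for \<theta> where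
  mono: "spanned \<theta> (scalar c * S4_mono I)"
| add: "spanned \<theta> p \<Longrightarrow> spanned \<theta> q \<Longrightarrow> spanned \<theta> (p + q)"
| eqv: "spanned \<theta> p \<Longrightarrow> eqv (S4_rels \<theta>) q p \<Longrightarrow> spanned \<theta> q"

lemma spanned_left:
  assumes "\<And>I. spanned \<theta> (r * S4_mono I)" and scalar: "\<And>c p. spanned \<theta> p \<Longrightarrow> spanned \<theta> (scalar c * p)"
  shows "spanned \<theta> p \<Longrightarrow> spanned \<theta> (r * p)"
proof (induction rule: spanned.induct)
  case (mono c I)
  show ?case
    using scalar[OF assms(1)] by (simp add: scalar_left_commute)
next
  case (eqv p q)
  then show ?case using spanned.eqv eqv_left by blast
qed (simp add: distrib_left spanned.add)

lemma spanned_scalar: "spanned \<theta> p \<Longrightarrow> spanned \<theta> (scalar c * p)"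
proof (induction rule: spanned.induct)
  case (eqv p q)
  then show ?case using spanned.eqv eqv_left by blast
qed (auto simp: scalar_scalar distrib_left intro: spanned.intros)

lemma spanned_mono: "spanned \<theta> (S4_mono I)"
  using spanned.mono[of \<theta> 1 I] by simp

lemma spanned_uminus: "spanned \<theta> p \<Longrightarrow> spanned \<theta> (- p)"
  using spanned_scalar[of \<theta> p "- 1"] by (simp add: scalar_def single_uminus)

lemma spanned_diff: "spanned \<theta> p \<Longrightarrow> spanned \<theta> q \<Longrightarrow> spanned \<theta> (p - q)"
  using spanned.add[OF _ spanned_uminus, of \<theta> p q] by simp

locale deformed_S4 =
  fixes \<theta> :: real
begin

abbreviation (input) S4_eqv (infix "\<simeq>" 50) where "p \<simeq> q \<equiv> eqv (S4_rels \<theta>) p q"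

abbreviation (input) "a \<equiv> gen S4_a"
abbreviation (input) "z \<equiv> gen S4_z"
abbreviation (input) "w \<equiv> gen S4_w"

lemma S4_selfadjoint: "adj a \<simeq> a"
  by (rule eqv_rel) (simp add: S4_rels_def Let_def selfadjoint_def)

lemma S4_central: "qc (S4_rels \<theta>) 1 (gen g) a" "qc (S4_rels \<theta>) 1 (adj (gen g)) a"
proof -
  have "central a \<subseteq> S4_rels \<theta>"
    by (auto simp: S4_rels_def Let_def)
  then have "a * gen g \<simeq> gen g * a" "a * adj (gen g) \<simeq> adj (gen g) * a"
    by (auto simp: central_def intro!: eqv_rel)
  then show "qc (S4_rels \<theta>) 1 (gen g) a" "qc (S4_rels \<theta>) 1 (adj (gen g)) a"
    by (auto simp: qc_1_commute intro: eqv_sym)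
qed

lemma S4_normal: "z * adj z \<simeq> adj z * z" "w * adj w \<simeq> adj w * w"
  by (rule eqv_rel; simp add: S4_rels_def Let_def normal_elt_def)+

lemma S4_sphere: "adj w * w \<simeq> a - a * a - adj z * z"
proof -
  have "adj z * z + adj w * w \<simeq> a * (1 - a)"
    by (rule eqv_rel) (simp add: S4_rels_def Let_def)
  then show ?thesis by (simp add: eqv_def algebra_simps)
qed

lemma S4_qc:
  "qc (S4_rels \<theta>) (cis \<theta>) w z" "qc (S4_rels \<theta>) (cis (- \<theta>)) w (adj z)"
  "qc (S4_rels \<theta>) (cis (- \<theta>)) (adj w) z" "qc (S4_rels \<theta>) (cis \<theta>) (adj w) (adj z)"
proof -
  have *: "qc (S4_rels \<theta>) (cis (- \<theta>)) z w" "qc (S4_rels \<theta>) (cis \<theta>) z (adj w)"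
    unfolding qc_def by (rule eqv_rel; simp add: S4_rels_def Let_def mult.assoc)+
  show "qc (S4_rels \<theta>) (cis \<theta>) w z" "qc (S4_rels \<theta>) (cis (- \<theta>)) w (adj z)"
    "qc (S4_rels \<theta>) (cis (- \<theta>)) (adj w) z" "qc (S4_rels \<theta>) (cis \<theta>) (adj w) (adj z)"
    using *[THEN qc_swap] *[THEN qc_adj] by (simp_all add: cis_cnj)
qed

lemma spanned_left_a: "spanned \<theta> p \<Longrightarrow> spanned \<theta> (a * p)"
proof (erule spanned_left[rotated 2])
  fix I :: "nat \<times> nat \<times> nat \<times> int"
  obtain i j k l where I: "I = (i, j, k, l)" by (cases I)
  show "spanned \<theta> (a * S4_mono I)"
    using spanned_mono[of \<theta> "(Suc i, j, k, l)"] by (simp add: I mult.assoc)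
qed (rule spanned_scalar)

lemma spanned_left_z: "spanned \<theta> p \<Longrightarrow> spanned \<theta> (z * p)"
proof (erule spanned_left[rotated 2])
  fix I :: "nat \<times> nat \<times> nat \<times> int"
  obtain i j k l where I: "I = (i, j, k, l)" by (cases I)
  have "z * S4_mono I \<simeq> S4_mono (i, Suc j, k, l)"
    using qc_left[OF qc_power[OF S4_central(1)]] by (simp add: I mult.assoc)
  then show "spanned \<theta> (z * S4_mono I)"
    using spanned.eqv[OF spanned_mono] by blast
qed (rule spanned_scalar)

lemma spanned_left_adj_z: "spanned \<theta> p \<Longrightarrow> spanned \<theta> (adj z * p)"
proof (erule spanned_left[rotated 2])
  fix I :: "nat \<times> nat \<times> nat \<times> int"
  obtain i j k l where I: "I = (i, j, k, l)" by (cases I)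
  have "qc (S4_rels \<theta>) 1 (adj z) z"
    using S4_normal(1) by (simp add: qc_1_commute eqv_sym)
  \<comment> \<open>\<open>adj z\<close> passes \<open>a ^ i\<close> by centrality and
    \<open>z ^ j\<close> by normality, then joins \<open>adj z ^ k\<close>.\<close>
  then have "qc (S4_rels \<theta>) 1 (adj z) (a ^ i * z ^ j)"
    using qc_mult[OF qc_power[OF S4_central(2)] qc_power] by fastforce
  then have "adj z * S4_mono I \<simeq> S4_mono (i, j, Suc k, l)"
    using qc_left[of _ _ _ "a ^ i * z ^ j"] by (fastforce simp: I mult.assoc)
  then show "spanned \<theta> (adj z * S4_mono I)"
    using spanned.eqv[OF spanned_mono] by blast
qed (rule spanned_scalar)

abbreviation (input) "sphere \<equiv> a - a * a - adj z * z"

lemma spanned_left_sphere: "spanned \<theta> p \<Longrightarrow> spanned \<theta> (sphere * p)"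
  by (simp add: left_diff_distrib mult.assoc spanned_diff spanned_left_a spanned_left_z spanned_left_adj_z)

text \<open>\<open>sphere\<close> is a polynomial in \<open>a\<close>, \<open>z\<close> and
  \<open>adj z\<close>, which commute pairwise. The swaps occur because \<open>qc_mult\<close> and
  \<open>qc_power\<close> build up the right-hand argument.\<close>

lemma S4_sphere_commute: "qc (S4_rels \<theta>) 1 (a ^ i * (z ^ j * adj z ^ k)) sphere"
proof -
  have "qc (S4_rels \<theta>) 1 z (adj z)" "qc (S4_rels \<theta>) 1 (adj z) z"
    using S4_normal(1) by (simp_all add: qc_1_commute eqv_sym)
  then have "qc (S4_rels \<theta>) 1 p sphere" if "p \<in> {a, z, adj z}" for p
    using that S4_central(1)[of S4_z, THEN qc_swap] S4_central(2)[of S4_z, THEN qc_swap]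
    by (auto intro!: qc_diff_right qc_mult[of _ 1 _ _ 1, simplified] S4_central)
  then have "qc (S4_rels \<theta>) 1 sphere p" if "p \<in> {a, z, adj z}" for p
    using qc_swap[of "S4_rels \<theta>" 1 p sphere] that by simp
  then have "qc (S4_rels \<theta>) (1 ^ i * (1 ^ j * 1 ^ k)) sphere (a ^ i * (z ^ j * adj z ^ k))"
    by (intro qc_mult qc_power) auto
  then show ?thesis using qc_swap by fastforce
qed

text \<open>Intended for \<open>p = w\<close> and \<open>p = adj w\<close>. The factor passes the
  block in \<open>a\<close>, \<open>z\<close>, \<open>adj z\<close> at the cost of a phase, then
  either extends \<open>wpow l\<close> or meets an opposite letter; the resulting
  \<open>sphere\<close> moves back to the front, where it preserves the span.\<close>

lemma spanned_left_wpow: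
  assumes qc: "\<And>i j k. \<exists>\<mu>. qc (S4_rels \<theta>) \<mu> p (a ^ i * (z ^ j * adj z ^ k))"
    and p: "\<And>l. \<exists>m. p * wpow l \<simeq> wpow m \<or> p * wpow l \<simeq> sphere * wpow m"
  shows "spanned \<theta> q \<Longrightarrow> spanned \<theta> (p * q)"
proof (erule spanned_left[rotated 2])
  fix I :: "nat \<times> nat \<times> nat \<times> int"
  obtain i j k l where I: "I = (i, j, k, l)" by (cases I)
  let ?B = "a ^ i * (z ^ j * adj z ^ k)"
  obtain \<mu> where "qc (S4_rels \<theta>) \<mu> p ?B" using qc by blast
  then have 1: "p * S4_mono I \<simeq> scalar \<mu> * (?B * (p * wpow l))"
    unfolding I S4_mono.simps by (rule qc_left)
  obtain m where "p * wpow l \<simeq> wpow m \<or> p * wpow l \<simeq> sphere * wpow m"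
    using p by blast
  then have "spanned \<theta> (?B * (p * wpow l))"
  proof
    assume "p * wpow l \<simeq> wpow m"
    from eqv_left[OF this, of ?B] show ?thesis
      using spanned_mono[of \<theta> "(i, j, k, m)"] spanned.eqv by auto
  next
    assume "p * wpow l \<simeq> sphere * wpow m"
    then have "?B * (p * wpow l) \<simeq> ?B * (sphere * wpow m)"
      by (rule eqv_left)
    also have "\<dots> \<simeq> sphere * S4_mono (i, j, k, m)"
      using qc_left[OF S4_sphere_commute] by simp
    finally show ?thesis
      using spanned_left_sphere[OF spanned_mono] spanned.eqv by blast
  qed
  then show "spanned \<theta> (p * S4_mono I)"
    using 1 spanned.eqv spanned_scalar by blast
qed (rule spanned_scalar)

lemma wpow_pos: "l \<ge> 0 \<Longrightarrow> wpow (l + 1) = w * wpow l"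
  by (simp add: wpow_def nat_add_distrib)

lemma wpow_neg: "l \<le> 0 \<Longrightarrow> wpow (l - 1) = adj w * wpow l"
proof -
  assume l: "l \<le> 0"
  then have "nat (- (l - 1)) = Suc (nat (- l))" by simp
  then show ?thesis using l by (auto simp: wpow_def)
qed

lemma spanned_left_w: "spanned \<theta> p \<Longrightarrow> spanned \<theta> (w * p)"
proof (rule spanned_left_wpow)
  show "\<exists>\<mu>. qc (S4_rels \<theta>) \<mu> w (a ^ i * (z ^ j * adj z ^ k))" for i j k
    by (rule exI, rule qc_mult[OF qc_power[OF S4_central(1)] qc_mult[OF qc_power qc_power]], (rule S4_qc)+)
  show "\<exists>m. w * wpow l \<simeq> wpow m \<or> w * wpow l \<simeq> sphere * wpow m" for l
  proof (cases "l \<ge> 0")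
    case True
    then show ?thesis by (metis eqv_refl wpow_pos)
  next
    case False
    \<comment> \<open>Since \<open>l < 0\<close>, the index \<open>l + 1\<close> is still
      nonpositive and \<open>wpow_neg\<close> splits off one \<open>adj w\<close>.\<close>
    have "w * wpow l = (w * adj w) * wpow (l + 1)"
      using False wpow_neg[of "l + 1"] by (simp add: mult.assoc)
    moreover have "\<dots> \<simeq> sphere * wpow (l + 1)"
      by (intro eqv_right eqv_trans[OF S4_normal(2) S4_sphere])
    ultimately show ?thesis by metis
  qed
qed

lemma spanned_left_adj_w: "spanned \<theta> p \<Longrightarrow> spanned \<theta> (adj w * p)"
proof (rule spanned_left_wpow)
  show "\<exists>\<mu>. qc (S4_rels \<theta>) \<mu> (adj w) (a ^ i * (z ^ j * adj z ^ k))" for i j k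
    by (rule exI, rule qc_mult[OF qc_power[OF S4_central(2)] qc_mult[OF qc_power qc_power]], (rule S4_qc)+)
  show "\<exists>m. adj w * wpow l \<simeq> wpow m \<or> adj w * wpow l \<simeq> sphere * wpow m" for l
  proof (cases "l \<le> 0")
    case True
    then show ?thesis by (metis eqv_refl wpow_neg)
  next
    case False
    have "adj w * wpow l = (adj w * w) * wpow (l - 1)"
      using False wpow_pos[of "l - 1"] by (simp add: mult.assoc)
    moreover have "\<dots> \<simeq> sphere * wpow (l - 1)"
      by (intro eqv_right S4_sphere)
    ultimately show ?thesis by metis
  qed
qed

text \<open>Words are built by prepending letters, and the span is stable under left multiplication
  by each; the letter \<open>adj a\<close> is exchanged for \<open>a\<close>.\<close>

lemma spanned_all: "spanned \<theta> p"
proof (induction p rule: free_induct)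
  case (single u c)
  have "spanned \<theta> (Poly_Mapping.single (Word ls) c)" for ls
  proof (induction ls)
    case Nil
    show ?case
      using spanned.mono[of \<theta> c "(0, 0, 0, 0)"]
      by (simp add: wpow_def scalar_def zero_word_def)
  next
    case (Cons l ls)
    have "spanned \<theta> (gen g * q)" "spanned \<theta> (adj (gen g) * q)" if "spanned \<theta> q" for g q
      using that spanned_left_a spanned_left_z spanned_left_w spanned_left_adj_z spanned_left_adj_w
        spanned.eqv[OF spanned_left_a eqv_right[OF S4_selfadjoint]]
      by (cases g; simp)+
    moreover have "Poly_Mapping.single (Word (l # ls)) c =
        (case l of Gen g \<Rightarrow> gen g | Adj g \<Rightarrow> adj (gen g)) * Poly_Mapping.single (Word ls) c"
      by (cases l) (simp_all add: gen_def adj_single mult_single plus_word_def word_adj_def)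
    ultimately show ?case using Cons by (cases l) auto
  qed
  then show ?case by (metis word.collapse)
qed (rule spanned.add)

end

text \<open>Finitely supported coefficients list each index once, so equal monomials are already
  collected when coefficients are tested for vanishing.\<close>

definition S4_comb :: "(nat \<times> nat \<times> nat \<times> int \<Rightarrow>\<^sub>0 complex) \<Rightarrow> S4_gen free"
  where "S4_comb q = (\<Sum>I\<in>Poly_Mapping.keys q. scalar (Poly_Mapping.lookup q I) * S4_mono I)"

lemma S4_normal_form: "\<exists>q. eqv (S4_rels \<theta>) p (S4_comb q)"
  using deformed_S4.spanned_all[of \<theta> p]
proof (induction rule: spanned.induct)
  case (mono c I)
  have "scalar c * S4_mono I = S4_comb (Poly_Mapping.single I c)"
    by (cases "c = 0") (simp_all add: S4_comb_def)
  then show ?case by (metis eqv_refl)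
next
  case (add p p')
  have "S4_comb (q + q') = S4_comb q + S4_comb q'" for q q'
    unfolding S4_comb_def
    by (rule setsum_keys_plus_distrib) (simp_all add: scalar_add distrib_right)
  then show ?case using add.IH eqv_add by metis
next
  case (eqv p q)
  then show ?case using eqv_trans by blast
qed


section \<open>Weighted shifts\<close>

text \<open>A word acts as a composite of weighted shifts, its last letter first. A generator and
  its adjoint receive independent weights and shifts.\<close>

definition act :: "('g letter \<Rightarrow> 'x \<Rightarrow> complex) \<Rightarrow> ('g letter \<Rightarrow> 'x \<Rightarrow> 'x) \<Rightarrow>
    'g free \<Rightarrow> ('x \<Rightarrow> complex) \<Rightarrow> 'x \<Rightarrow> complex"
  where "act \<kappa> \<sigma> p f X = (\<Sum>u\<in>Poly_Mapping.keys p. Poly_Mapping.lookup p u *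
    foldr (\<lambda>l f X. \<kappa> l X * f (\<sigma> l X)) (letters u) f X)"

lemma act_single: "act \<kappa> \<sigma> (Poly_Mapping.single u c) f X =
    c * foldr (\<lambda>l f X. \<kappa> l X * f (\<sigma> l X)) (letters u) f X"
  by (cases "c = 0") (simp_all add: act_def)

lemma act_add: "act \<kappa> \<sigma> (p + q) f X = act \<kappa> \<sigma> p f X + act \<kappa> \<sigma> q f X"
  unfolding act_def by (rule setsum_keys_plus_distrib) (simp_all add: distrib_right)

lemma act_zero [simp]: "act \<kappa> \<sigma> 0 f X = 0"
  by (simp add: act_def)

lemma act_diff: "act \<kappa> \<sigma> (p - q) f X = act \<kappa> \<sigma> p f X - act \<kappa> \<sigma> q f X"
  using act_add[of \<kappa> \<sigma> "p - q" q f X] by simp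

text \<open>Linearity in the function lets the outer operator in \<open>act_mult\<close> be
  distributed over the words of the inner factor.\<close>

lemma act_linear: "act \<kappa> \<sigma> p (\<lambda>X. c * f X + g X) X = c * act \<kappa> \<sigma> p f X + act \<kappa> \<sigma> p g X"
proof (induction p arbitrary: X rule: free_induct)
  case (single u d)
  have "foldr (\<lambda>l f X. \<kappa> l X * f (\<sigma> l X)) ls (\<lambda>X. c * f X + g X) X =
      c * foldr (\<lambda>l f X. \<kappa> l X * f (\<sigma> l X)) ls f X +
      foldr (\<lambda>l f X. \<kappa> l X * f (\<sigma> l X)) ls g X" for ls X
    by (induction ls arbitrary: X) (simp_all add: algebra_simps)
  then show ?case by (simp add: act_single algebra_simps)
qed (simp add: act_add algebra_simps)

lemma act_zero_right [simp]: "act \<kappa> \<sigma> p (\<lambda>_. 0) X = 0"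
  using act_linear[of \<kappa> \<sigma> p "-1" "\<lambda>_. 0" "\<lambda>_. 0"] by simp

lemma act_cmult: "act \<kappa> \<sigma> p (\<lambda>X. c * f X) X = c * act \<kappa> \<sigma> p f X"
  using act_linear[of \<kappa> \<sigma> p c f "\<lambda>_. 0"] by simp

lemma act_mult: "act \<kappa> \<sigma> (p * q) f X = act \<kappa> \<sigma> p (act \<kappa> \<sigma> q f) X"
proof (induction q arbitrary: X rule: free_induct)
  case (single v d)
  show ?case
  proof (induction p arbitrary: X rule: free_induct)
    case (single u c)
    have eq: "act \<kappa> \<sigma> (Poly_Mapping.single v d) f =
        (\<lambda>X. d * foldr (\<lambda>l f X. \<kappa> l X * f (\<sigma> l X)) (letters v) f X)"
      by (simp add: act_single fun_eq_iff)
    then have "act \<kappa> \<sigma> (Poly_Mapping.single u c) (act \<kappa> \<sigma> (Poly_Mapping.single v d) f) X =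
        d * act \<kappa> \<sigma> (Poly_Mapping.single u c) (foldr (\<lambda>l f X. \<kappa> l X * f (\<sigma> l X)) (letters v) f) X"
      by (simp only: act_cmult)
    then show ?case
      by (auto simp: mult_single act_single plus_word_def eq)
  qed (simp add: distrib_right act_add)
next
  case (add p' q)
  have "act \<kappa> \<sigma> p (act \<kappa> \<sigma> (p' + q) f) X =
      act \<kappa> \<sigma> p (\<lambda>X. 1 * act \<kappa> \<sigma> p' f X + act \<kappa> \<sigma> q f X) X"
    by (simp add: act_add[abs_def])
  also have "\<dots> = act \<kappa> \<sigma> p (act \<kappa> \<sigma> p' f) X + act \<kappa> \<sigma> p (act \<kappa> \<sigma> q f) X"
    unfolding act_linear by simp
  finally show ?case
    by (simp only: distrib_left act_add[of _ _ "p * p'"] add.IH)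
qed

lemma act_scalar [simp]: "act \<kappa> \<sigma> (scalar c) f X = c * f X"
  by (simp add: scalar_def act_single zero_word_def)

lemma act_one [simp]: "act \<kappa> \<sigma> 1 f X = f X"
  using act_scalar[of \<kappa> \<sigma> 1] by simp

lemma act_gen [simp]: "act \<kappa> \<sigma> (gen g) f X = \<kappa> (Gen g) X * f (\<sigma> (Gen g) X)"
  by (simp add: gen_def act_single)

lemma act_adj_gen [simp]: "act \<kappa> \<sigma> (adj (gen g)) f X = \<kappa> (Adj g) X * f (\<sigma> (Adj g) X)"
  by (simp add: gen_def act_single adj_single word_adj_def)

text \<open>The adjoint relations form a separate hypothesis because the weights need not be
  compatible with the involution.\<close>

lemma act_rel_ideal:
  assumes "\<And>l r f X. (l, r) \<in> S \<Longrightarrow> act \<kappa> \<sigma> l f X = act \<kappa> \<sigma> r f X"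
    and "\<And>l r f X. (l, r) \<in> S \<Longrightarrow> act \<kappa> \<sigma> (adj l) f X = act \<kappa> \<sigma> (adj r) f X"
    and "p \<in> rel_ideal S"
  shows "act \<kappa> \<sigma> p f X = 0"
proof -
  \<comment> \<open>Killing every function, not just the given one, makes this set closed under
    right multiplication, where the element is applied to the result of another action.\<close>
  have "rel_ideal S \<subseteq> {p. \<forall>f. act \<kappa> \<sigma> p f = (\<lambda>_. 0)}"
    by (rule rel_ideal_minimal)
      (use assms(1,2) in \<open>auto intro!: ext simp: act_add act_mult act_diff adj_diff\<close>)
  then show ?thesis using assms(3) by auto
qed

text \<open>The generators \<open>a, b, c\<close> act on functions of \<open>(A, t, n, m)\<close> as \<open>A\<close>, \<open>B = 1 - A - t\<close>, \<open>t\<close>, while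
  \<open>d, z, u, v\<close> act as \<open>0\<close>. The generators \<open>y\<close> and \<open>w\<close> act as the unitaries \<open>U, V\<close> of a quantum torus;
  as no compatibility with the involution is needed, their adjoints carry the full weights \<open>A t\<close>
  and \<open>B t\<close>, which avoids square roots. The relation \<open>c x = y w\<^sup>*\<close> then forces \<open>x = B U V\<^sup>-\<^sup>1\<close>, and its
  adjoint gives \<open>x\<^sup>* = A V U\<^sup>-\<^sup>1\<close>.\<close>

definition CP3_weight :: "real \<Rightarrow> CP3_gen letter \<Rightarrow> complex \<times> complex \<times> int \<times> int \<Rightarrow> complex"
  where "CP3_weight \<theta> l = (\<lambda>(A, t, n, m). case l of
      Gen g \<Rightarrow> (case g of CP3_a \<Rightarrow> A | CP3_b \<Rightarrow> 1 - A - t | CP3_c \<Rightarrow> t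
        | CP3_x \<Rightarrow> cis (- (of_int (n - 1) * \<theta>)) * (1 - A - t) | CP3_y \<Rightarrow> 1
        | CP3_w \<Rightarrow> cis (of_int n * \<theta>) | _ \<Rightarrow> 0)
    | Adj g \<Rightarrow> (case g of CP3_a \<Rightarrow> A | CP3_b \<Rightarrow> 1 - A - t | CP3_c \<Rightarrow> t
        | CP3_x \<Rightarrow> cis (of_int n * \<theta>) * A | CP3_y \<Rightarrow> A * t
        | CP3_w \<Rightarrow> cis (- (of_int n * \<theta>)) * ((1 - A - t) * t) | _ \<Rightarrow> 0))"

text \<open>\<open>A\<close> and \<open>t\<close> are never moved, which keeps \<open>a\<close>,
  \<open>b\<close>, \<open>c\<close> central. The shift of \<open>n\<close> by \<open>y\<close>
  changes the factor \<open>cis (of_int n * \<theta>)\<close> in the weight of \<open>w\<close>,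
  which produces the commutation phase.\<close>

definition CP3_shift :: "CP3_gen letter \<Rightarrow>
    complex \<times> complex \<times> int \<times> int \<Rightarrow> complex \<times> complex \<times> int \<times> int"
  where "CP3_shift l = (\<lambda>(A, t, n, m). case l of
      Gen g \<Rightarrow> (case g of CP3_x \<Rightarrow> (A, t, n - 1, m + 1) | CP3_y \<Rightarrow> (A, t, n - 1, m)
        | CP3_w \<Rightarrow> (A, t, n, m - 1) | _ \<Rightarrow> (A, t, n, m))
    | Adj g \<Rightarrow> (case g of CP3_x \<Rightarrow> (A, t, n + 1, m - 1) | CP3_y \<Rightarrow> (A, t, n + 1, m)
        | CP3_w \<Rightarrow> (A, t, n, m + 1) | _ \<Rightarrow> (A, t, n, m)))"

abbreviation rep :: "real \<Rightarrow> CP3_gen free \<Rightarrow> (complex \<times> complex \<times> int \<times> int \<Rightarrow> complex) \<Rightarrow>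
    complex \<times> complex \<times> int \<times> int \<Rightarrow> complex"
  where "rep \<theta> \<equiv> act (CP3_weight \<theta>) CP3_shift"

lemma rep_central:
  assumes "(l, r) \<in> selfadjoint p \<union> central p" "p \<in> {gen CP3_a, gen CP3_b, gen CP3_c, gen CP3_d}"
  shows "rep \<theta> l f X = rep \<theta> r f X" "rep \<theta> (adj l) f X = rep \<theta> (adj r) f X"
proof -
  obtain A t n m where X: "X = (A, t, n, m)" by (cases X)
  obtain g where p: "p = gen g" and g: "g \<in> {CP3_a, CP3_b, CP3_c, CP3_d}"
    using assms(2) by blast
  have g1: "rep \<theta> (gen g) f Y = CP3_weight \<theta> (Gen g) Y * f Y" "rep \<theta> (adj (gen g)) f Y = CP3_weight \<theta> (Gen g) Y * f Y"
    for f Y using g by (auto simp: CP3_weight_def CP3_shift_def split: prod.splits)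
  have inv: "CP3_weight \<theta> (Gen g) (CP3_shift l Y) = CP3_weight \<theta> (Gen g) Y" for l Y
    using g by (auto simp: CP3_weight_def CP3_shift_def split: prod.splits letter.splits CP3_gen.splits)
  show "rep \<theta> l f X = rep \<theta> r f X" "rep \<theta> (adj l) f X = rep \<theta> (adj r) f X"
    using assms(1) unfolding p selfadjoint_def central_def
    by (auto simp: act_mult adj_mult g1[abs_def] inv mult_ac)
qed

lemma rep_rels:
  assumes "(l, r) \<in> CP3_rels \<theta>"
  shows "rep \<theta> l f X = rep \<theta> r f X \<and> rep \<theta> (adj l) f X = rep \<theta> (adj r) f X"
proof -
  obtain A t n m where X: "X = (A, t, n, m)" by (cases X)
  note weights = act_mult[abs_def] act_add[abs_def] act_diff[abs_def] adj_mult adj_add adj_diff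
    CP3_weight_def CP3_shift_def
  have cis_left: "cis \<alpha> * (cis \<beta> * s) = cis (\<alpha> + \<beta>) * s" for \<alpha> \<beta> s
    by (simp add: cis_mult mult.assoc[symmetric])
  \<comment> \<open>Centrality ranges over all generators and is left to \<open>rep_central\<close>;
    the rest is a finite list of explicit weight identities.\<close>
  from assms consider
      p where "p \<in> {gen CP3_a, gen CP3_b, gen CP3_c, gen CP3_d}" "(l, r) \<in> selfadjoint p \<union> central p"
    | "(l, r) \<in> CP3_rels \<theta> - (\<Union>p\<in>{gen CP3_a, gen CP3_b, gen CP3_c, gen CP3_d}. selfadjoint p \<union> central p)"
    by blast
  then show ?thesis
  proof cases
    case 1
    then show ?thesis using rep_central by blast
  next
    case 2
    then show ?thesis
      unfolding CP3_rels_def Let_def normal_elt_def qcomm_def UN_insert UN_empty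
      by (elim DiffE UnE insertE emptyE, simp_all only: X Un_iff simp_thms prod.inject)
        (simp_all add: weights cis_cnj, simp_all add: algebra_simps cis_mult cis_left)
  qed
qed


section \<open>Images of the sphere monomials under the weighted shifts\<close>

lemma rep_eta_a: "rep \<theta> (eta_gen \<theta> S4_a ^ i) f (A, t, n, m) = (1 - t) ^ i * f (A, t, n, m)"
  by (induction i)
    (simp_all add: eta_gen_def act_mult act_add CP3_weight_def CP3_shift_def algebra_simps)

lemma rep_eta_z: "rep \<theta> (eta_gen \<theta> S4_z ^ j) f (A, t, n, m) =
    cis \<theta> ^ j * f (A, t, n - int j, m)"
  by (induction j arbitrary: n)
    (simp_all add: eta_gen_def act_mult act_add CP3_weight_def CP3_shift_def algebra_simps)

lemma rep_eta_adj_z: "rep \<theta> (adj (eta_gen \<theta> S4_z) ^ k) f (A, t, n, m) =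
    cis (- \<theta>) ^ k * (A * t) ^ k * f (A, t, n + int k, m)"
  by (induction k arbitrary: n)
    (simp_all add: eta_gen_def adj_add adj_mult act_mult act_add cis_cnj
      CP3_weight_def CP3_shift_def algebra_simps)

lemma rep_eta_w: "rep \<theta> (eta_gen \<theta> S4_w ^ k) f (A, t, n, m) =
    cis (of_int n * \<theta>) ^ k * f (A, t, n, m - int k)"
  by (induction k arbitrary: m)
    (simp_all add: eta_gen_def act_mult act_diff CP3_weight_def CP3_shift_def algebra_simps)

lemma rep_eta_adj_w: "rep \<theta> (adj (eta_gen \<theta> S4_w) ^ k) f (A, t, n, m) =
    cis (- (of_int n * \<theta>)) ^ k * ((1 - A - t) * t) ^ k * f (A, t, n, m + int k)"
  by (induction k arbitrary: m)
    (simp_all add: eta_gen_def adj_diff act_mult act_diff CP3_weight_def CP3_shift_def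
      algebra_simps)

text \<open>The indicator of the lattice origin separates bidegrees. Phases from powers of the image
  of \<open>w\<close> disappear because they are read off at \<open>n = 0\<close>.\<close>

lemma rep_eta_mono:
  assumes "f = (\<lambda>(A, t, n, m). if n = 0 \<and> m = 0 then 1 else 0)"
  shows "rep \<theta> (ev (eta_gen \<theta>) (S4_mono (i, j, k, l))) f (A, t, n, m) =
    (if n = int j - int k \<and> m = l
     then cis \<theta> ^ j * cis (- \<theta>) ^ k * ((1 - A - t) * t) ^ nat (- l) * (1 - t) ^ i * (A * t) ^ k
     else 0)"
proof -
  have "rep \<theta> (ev (eta_gen \<theta>) (wpow l)) f (A, t, n, m) =
      (if n = 0 \<and> m = l then ((1 - A - t) * t) ^ nat (- l) else 0)" for n
    by (auto simp: wpow_def ev_power ev_adj rep_eta_w rep_eta_adj_w assms)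
  then show ?thesis
    by (auto simp: ev_mult ev_power ev_adj act_mult rep_eta_a rep_eta_z rep_eta_adj_z)
qed

section \<open>Injectivity\<close>

text \<open>Grouping by exponent gives a polynomial with infinitely many roots. As \<open>e\<close>
  may take equal values, only the sum over each fibre is forced to vanish.\<close>

lemma power_sum_zero:
  fixes g :: "'i \<Rightarrow> complex" and e :: "'i \<Rightarrow> nat"
  assumes F: "finite F" and X: "infinite X" and zero: "\<And>x. x \<in> X \<Longrightarrow> (\<Sum>I\<in>F. g I * x ^ e I) = 0"
  shows "(\<Sum>I\<in>{I \<in> F. e I = k}. g I) = 0"
proof (rule ccontr)
  assume k: "(\<Sum>I\<in>{I \<in> F. e I = k}. g I) \<noteq> 0"
  define c where "c k = (\<Sum>I\<in>{I \<in> F. e I = k}. g I)" for k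
  \<comment> \<open>Inserting \<open>k\<close> keeps the set nonempty and gives
    \<open>k \<le> n\<close> at once.\<close>
  define n where "n = Max (insert k (e ` F))"
  have "(\<Sum>i\<le>n. c i * x ^ i) = (\<Sum>I\<in>F. g I * x ^ e I)" for x
  proof -
    have "(\<Sum>i\<le>n. c i * x ^ i) = (\<Sum>i\<le>n. \<Sum>I\<in>{I \<in> F. e I = i}. g I * x ^ e I)"
      unfolding c_def sum_distrib_right by (intro sum.cong refl) auto
    also have "\<dots> = (\<Sum>I\<in>F. g I * x ^ e I)"
      using F by (intro sum.group) (auto simp: n_def)
    finally show ?thesis .
  qed
  then have "X \<subseteq> {x. (\<Sum>i\<le>n. c i * x ^ i) = 0}"
    using zero by auto
  moreover have "k \<le> n"
    using F by (simp add: n_def)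
  moreover have "c k \<noteq> 0"
    using k by (simp add: c_def)
  ultimately have "finite X"
    using polyfun_rootbound[of c k n] by (blast intro: finite_subset)
  then show False using X by contradiction
qed

text \<open>Coefficients are isolated in three stages: the point \<open>(n, l0)\<close> selects a
  bidegree, varying \<open>P = A * t\<close> at fixed \<open>s = 1 - t\<close> selects
  \<open>k0\<close>, and varying \<open>s\<close> selects \<open>i0\<close>.\<close>

lemma S4_comb_eta_zero:
  assumes "ev (eta_gen \<theta>) (S4_comb q) \<in> rel_ideal (CP3_rels \<theta>)"
  shows "q = 0"
proof (rule poly_mapping_eqI)
  fix I0 :: "nat \<times> nat \<times> nat \<times> int"
  obtain i0 j0 k0 l0 where I0: "I0 = (i0, j0, k0, l0)" by (cases I0)
  define f :: "complex \<times> complex \<times> int \<times> int \<Rightarrow> complex"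
    where "f = (\<lambda>(A, t, n, m). if n = 0 \<and> m = 0 then 1 else 0)"
  define n where "n = int j0 - int k0"
  define F where "F = {(i, j, k, l) \<in> Poly_Mapping.keys q. n = int j - int k \<and> l0 = l}"
  \<comment> \<open>The phases absorbed into \<open>g\<close> are nonzero, so vanishing of
    \<open>g\<close> still forces the coefficient to vanish.\<close>
  define g where "g = (\<lambda>(i, j, k, l). Poly_Mapping.lookup q (i, j, k, l) * cis \<theta> ^ j * cis (- \<theta>) ^ k)"
  define e1 :: "nat \<times> nat \<times> nat \<times> int \<Rightarrow> nat" where "e1 = (\<lambda>(i, j, k, l). i)"
  define e2 :: "nat \<times> nat \<times> nat \<times> int \<Rightarrow> nat" where "e2 = (\<lambda>(i, j, k, l). k)"
  have F: "finite F"
    unfolding F_def by (rule finite_subset[OF _ finite_keys[of q]]) auto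
  \<comment> \<open>The condition \<open>nz\<close> permits cancelling the common factor
    \<open>?\<beta>\<close> left by powers of the image of \<open>adj w\<close>.\<close>
  have sum_At: "(\<Sum>I\<in>F. g I * (1 - t) ^ e1 I * (A * t) ^ e2 I) = 0" if nz: "(1 - A - t) * t \<noteq> 0" for A t
  proof -
    let ?\<beta> = "((1 - A - t) * t) ^ nat (- l0)"
    have ev: "ev (eta_gen \<theta>) (S4_comb q) =
        (\<Sum>I\<in>Poly_Mapping.keys q. scalar (Poly_Mapping.lookup q I) * ev (eta_gen \<theta>) (S4_mono I))"
    proof -
      have "ev h (sum G K) = (\<Sum>I\<in>K. ev h (G I))" if "finite K" for h :: "S4_gen \<Rightarrow> CP3_gen free" and G and K :: "(nat \<times> nat \<times> nat \<times> int) set"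
        using that by induction (simp_all add: ev_add)
      then show ?thesis by (simp add: S4_comb_def ev_mult)
    qed
    have act_sum: "rep \<theta> (sum G K) f X = (\<Sum>I\<in>K. rep \<theta> (G I) f X)" if "finite K" for G X and K :: "(nat \<times> nat \<times> nat \<times> int) set"
      using that by induction (simp_all add: act_add)
    have "0 = rep \<theta> (ev (eta_gen \<theta>) (S4_comb q)) f (A, t, n, l0)"
      by (rule act_rel_ideal[OF _ _ assms, symmetric]; drule rep_rels; blast)
    also have "\<dots> = (\<Sum>I\<in>Poly_Mapping.keys q. Poly_Mapping.lookup q I *
        rep \<theta> (ev (eta_gen \<theta>) (S4_mono I)) f (A, t, n, l0))"
      by (simp add: ev act_sum act_mult)
    also have "\<dots> = (\<Sum>I\<in>F. g I * (1 - t) ^ e1 I * (A * t) ^ e2 I * ?\<beta>)"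
    proof (rule sum.mono_neutral_cong_right)
      fix I assume "I \<in> F"
      then obtain i j k where "I = (i, j, k, l0)" "n = int j - int k"
        by (auto simp: F_def)
      then show "Poly_Mapping.lookup q I * rep \<theta> (ev (eta_gen \<theta>) (S4_mono I)) f (A, t, n, l0) =
          g I * (1 - t) ^ e1 I * (A * t) ^ e2 I * ?\<beta>"
        by (simp only: rep_eta_mono[OF f_def] g_def e1_def e2_def prod.case simp_thms if_True mult_ac)
    next
      show "\<forall>I\<in>Poly_Mapping.keys q - F. Poly_Mapping.lookup q I *
          rep \<theta> (ev (eta_gen \<theta>) (S4_mono I)) f (A, t, n, l0) = 0"
      proof
        fix I assume I: "I \<in> Poly_Mapping.keys q - F"
        obtain i j k l where ijkl: "I = (i, j, k, l)" by (cases I)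
        then have "\<not> (n = int j - int k \<and> l0 = l)"
          using I by (auto simp: F_def)
        then show "Poly_Mapping.lookup q I *
            rep \<theta> (ev (eta_gen \<theta>) (S4_mono I)) f (A, t, n, l0) = 0"
          by (simp only: ijkl rep_eta_mono[OF f_def] if_False mult_zero_right)
      qed
    qed (auto simp: F_def)
    also have "\<dots> = (\<Sum>I\<in>F. g I * (1 - t) ^ e1 I * (A * t) ^ e2 I) * ?\<beta>"
      by (simp add: sum_distrib_right)
    finally show ?thesis using nz by simp
  qed
  have *: "(\<Sum>I\<in>{I \<in> F. e2 I = k0}. g I * s ^ e1 I) = 0" if s: "s \<noteq> 1" for s
  proof (rule power_sum_zero[OF F])
    \<comment> \<open>The substitution is \<open>t = 1 - s\<close>, \<open>A = P / (1 - s)\<close>,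
      so \<open>A * t = P\<close>. The excluded \<open>P\<close> is where \<open>1 - A - t\<close>
      vanishes, and \<open>s \<noteq> 1\<close> keeps \<open>t\<close> nonzero.\<close>
    show "infinite (- {s * (1 - s)} :: complex set)"
      by (simp add: infinite_UNIV_char_0)
    fix P :: complex assume P: "P \<in> - {s * (1 - s)}"
    have "(1 - P / (1 - s) - (1 - s)) * (1 - s) = s * (1 - s) - P"
      using s by (simp add: field_simps)
    then have "(1 - P / (1 - s) - (1 - s)) * (1 - s) \<noteq> 0"
      using P by auto
    from sum_At[OF this] show "(\<Sum>I\<in>F. g I * s ^ e1 I * P ^ e2 I) = 0"
      using s by simp
  qed
  have "(\<Sum>I\<in>{I \<in> {I \<in> F. e2 I = k0}. e1 I = i0}. g I) = 0"
    by (rule power_sum_zero[of _ "- {1}"]) (use F * in \<open>auto simp: infinite_UNIV_char_0\<close>)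
  \<comment> \<open>The bidegree together with \<open>k0\<close> and \<open>i0\<close> determines
    all four indices, so the fibre contains at most \<open>I0\<close>.\<close>
  also have "{I \<in> {I \<in> F. e2 I = k0}. e1 I = i0} = (if I0 \<in> Poly_Mapping.keys q then {I0} else {})"
    by (auto simp: F_def e1_def e2_def n_def I0)
  finally show "Poly_Mapping.lookup q I0 = Poly_Mapping.lookup 0 I0"
    by (auto simp: g_def I0 in_keys_iff split: if_splits)
qed

lemma eta_injective:
  assumes "ev (eta_gen \<theta>) p \<in> rel_ideal (CP3_rels \<theta>)"
  shows "p \<in> rel_ideal (S4_rels \<theta>)"
proof -
  obtain q where q: "eqv (S4_rels \<theta>) p (S4_comb q)"
    using S4_normal_form by blast
  then have "eqv (CP3_rels \<theta>) (ev (eta_gen \<theta>) (S4_comb q)) (ev (eta_gen \<theta>) p)"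
    using ev_rel_ideal[OF deformed_CP3.eta_rels] eqv_sym unfolding eqv_def ev_diff[symmetric] by blast
  then have "ev (eta_gen \<theta>) (S4_comb q) \<in> rel_ideal (CP3_rels \<theta>)"
    using rel_ideal_add[OF _ assms] unfolding eqv_def by fastforce
  then have "S4_comb q = 0"
    using S4_comb_eta_zero[of \<theta> q] by (simp add: S4_comb_def)
  then show ?thesis using q by (simp add: eqv_def)
qed

section \<open>Descent to the quotient algebras\<close>

theorem proposition6p6:
  fixes \<theta> :: real
  shows "\<exists>\<eta>. \<eta> \<in> star_alg_hom (S4_alg \<theta>) (CP3_alg \<theta>) \<and>
    inj_on \<eta> (carrier (S4_alg \<theta>)) \<and>
    \<eta> (S4_el \<theta> S4_a) = CP3_el \<theta> CP3_a \<oplus>\<^bsub>CP3_alg \<theta>\<^esub> CP3_el \<theta> CP3_b \<and>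
    \<eta> (S4_el \<theta> S4_z) =
      (cis \<theta> \<odot>\<^bsub>CP3_alg \<theta>\<^esub> CP3_el \<theta> CP3_y) \<oplus>\<^bsub>CP3_alg \<theta>\<^esub> star (CP3_alg \<theta>) (CP3_el \<theta> CP3_v) \<and>
    \<eta> (S4_el \<theta> S4_w) =
      CP3_el \<theta> CP3_w \<ominus>\<^bsub>CP3_alg \<theta>\<^esub> star (CP3_alg \<theta>) (CP3_el \<theta> CP3_z)"
proof -
  let ?S = "S4_rels \<theta>" and ?C = "CP3_rels \<theta>" and ?h = "ev (eta_gen \<theta>)"
  \<comment> \<open>A representative is chosen for each class; by \<open>iff\<close> below, the
    value does not depend on the choice.\<close>
  define \<eta> where "\<eta> P = cls ?C (?h (SOME p. cls ?S p = P))" for P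
  \<comment> \<open>Read from right to left this is well-definedness, from left to right
    injectivity.\<close>
  have iff: "cls ?C (?h p) = cls ?C (?h q) \<longleftrightarrow> cls ?S p = cls ?S q" for p q
    using ev_rel_ideal[OF deformed_CP3.eta_rels[where \<theta> = \<theta>], where p = "p - q"] eta_injective[of \<theta> "p - q"]
    by (auto simp: cls_eq_iff eqv_def ev_diff)
  have \<eta>: "\<eta> (cls ?S p) = cls ?C (?h p)" for p
    unfolding \<eta>_def iff by (rule someI[of _ p]) simp
  have "\<eta> \<in> star_alg_hom (S4_alg \<theta>) (CP3_alg \<theta>)"
    unfolding star_alg_hom_def ring_hom_def S4_alg_def CP3_alg_def
    by (auto simp: carrier_presented \<eta> cls_mult cls_add cls_one cls_smult star_cls
        ev_mult ev_add ev_adj)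
  moreover have "inj_on \<eta> (carrier (S4_alg \<theta>))"
    by (auto simp: S4_alg_def carrier_presented inj_on_def \<eta> iff)
  moreover have "cls ?C p \<ominus>\<^bsub>presented ?C\<^esub> cls ?C q = cls ?C (p - q)" for p q
  proof -
    interpret star_algebra "presented ?C" by (rule star_algebra_presented)
    have "\<ominus>\<^bsub>presented ?C\<^esub> cls ?C q = cls ?C (- q)"
      by (rule minus_equality) (auto simp: cls_add cls_zero carrier_presented)
    then show ?thesis by (simp add: a_minus_def cls_add)
  qed
  ultimately show ?thesis
    by (intro exI[of _ \<eta>])
      (simp add: S4_el_def CP3_el_def S4_alg_def CP3_alg_def \<eta> cls_add cls_smult star_cls eta_gen_def)
qed

end
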